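(* Let $K\subset\mathbb R^n$ be a convex compact set with $\Gamma\subset K$ and $\mathcal X\subset K$. Let $H>0$, $k\in\mathbb N$, and let the cubature $\mathcal Q[f]=\sum_{i=1}^M w_i f(x_i)$ be exact on $\mathbb P_k$, i.e. $\mathcal Q[p]=\int_\Gamma p\,d\mu$ for all $p\in\mathbb P_k$. Then, for all $f\in\mathscr C^{k+1}(F_H)$ and all $0<h\le H$, $$\Bigl|\mathcal Q_h[f]-\int_\Gamma f\,d\mu\Bigr|\le C\,h^{k+1}\,\|\mathrm D^{k+1}f\|_{L^\infty(F_H)},$$ where $\|\mathrm D^{k+1}f\|_{L^\infty(F_H)}=\max_{|\boldsymbol\beta|_1=k+1}\|\partial^{\boldsymbol\beta}f\|_{L^\infty(F_H)}$ and $$C=\Bigl(\frac{\operatorname{diam}K}{\operatorname{diam}\Gamma}\Bigr)^{k+1}\bigl(|\mathbf w|_1+1\bigr)\sum_{|\boldsymbol\beta|_1=k+1}\frac1{\boldsymbol\beta!}.$$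
   Context: Affine IFS: $\mathscr S=\{S_\ell:\mathbb R^n\to\mathbb R^n\}_{\ell=1}^L$, $L\ge2$, with $S_\ell(x)=A_\ell x+b_\ell$ and spectral norm $\rho_\ell=\|A_\ell\|<1$. Its attractor $\Gamma$ is the unique nonempty compact set with $\Gamma=\bigcup_{\ell=1}^L S_\ell(\Gamma)$; assume $\operatorname{diam}\Gamma>0$. Fix $\mu_1,\dots,\mu_L\in(0,1)$ with $\sum_\ell\mu_\ell=1$; $\mu$ is the unique Borel regular probability measure (on a closed ball $F$ with $\bigcup_\ell S_\ell(F)\subset F$) satisfying $\mu=\sum_\ell\mu_\ell\,\mu\circ S_\ell^{-1}$; its support is $\Gamma$. $\mathbb P_k$ is the space of polynomials in $n$ variables of total degree $\le k$. The cubature $\mathcal Q$ has points $\mathcal X=\{x_1,\dots,x_M\}$, unisolvent for some finite-dimensional polynomial space $\mathcal P\supset\mathbb P_k$ with $\dim\mathcal P=M$ (i.e. $p\mapsto(p(x_i))_i$ is injective on $\mathcal P$), and weights $\mathbf w=(w_1,\dots,w_M)\in\mathbb R^M$; $|\mathbf w|_1=\sum_i|w_i|$. For a finite word $\mathbf m=(m_1,\dots,m_p)$ in the alphabet $\mathbb L=\{1,\dots,L\}$: $S_{\mathbf m}=S_{m_1}\circ\cdots\circ S_{m_p}$, $\rho_{\mathbf m}=\rho_{m_1}\cdots\rho_{m_p}$, $\mu_{\mathbf m}=\mu_{m_1}\cdots\mu_{m_p}$; for the empty word, $S_\emptyset=\mathrm{Id}$, $\rho_\emptyset=\mu_\emptyset=1$.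 Given $h>0$, define sets of words by $\mathcal L_h^0=\{\emptyset\}$, $\mathcal N_h^q=\{\mathbf m\in\mathcal L_h^q:\rho_{\mathbf m}\operatorname{diam}\Gamma>h\}$, and $$\mathcal L_h^{q+1}=(\mathcal L_h^q\setminus\mathcal N_h^q)\cup\{(m_1,\dots,m_q,\ell):(m_1,\dots,m_q)\in\mathcal N_h^q,\ \ell\in\mathbb L\}.$$ This sequence is stationary after finitely many steps, and $\mathcal L_h$ denotes its stationary value. Set $$\mathcal Q_h[f]=\sum_{\mathbf m\in\mathcal L_h}\mu_{\mathbf m}\,\mathcal Q[f\circ S_{\mathbf m}],\qquad K_h=\bigcup_{\mathbf m\in\mathcal L_h}S_{\mathbf m}(K),\qquad F_H=\bigcup_{0<\delta\le H}K_\delta .$$ $f\in\mathscr C^{k+1}(F_H)$ means that $f$ is (the restriction of) a function of class $\mathscr C^{k+1}$ on an open neighbourhood of $F_H$. *)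

theory Defs
  imports "HOL-Probability.Probability_Measure" "HOL-Library.Function_Algebras"
begin

section \<open>Affine iterated function systems, attractor and self-similar measure\<close>

definition affine_map :: "(nat \<Rightarrow> real^'n^'n) \<Rightarrow> (nat \<Rightarrow> real^'n) \<Rightarrow> nat \<Rightarrow> real^'n \<Rightarrow> real^'n"
  where "affine_map A b l x = A l *v x + b l"

definition spectral_norm :: "real^'n^'n \<Rightarrow> real"
  where "spectral_norm B = onorm (\<lambda>x. B *v x)"

definition is_attractor :: "nat \<Rightarrow> (nat \<Rightarrow> real^'n \<Rightarrow> real^'n) \<Rightarrow> (real^'n) set \<Rightarrow> bool"
  where "is_attractor L S \<Gamma> \<longleftrightarrow> \<Gamma> \<noteq> {} \<and> compact \<Gamma> \<and> \<Gamma> = (\<Union>l\<in>{1..L}. S l ` \<Gamma>)"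

text \<open>
  The measure lives on all of the space and is concentrated on a closed ball that every map
  sends into itself. Regularity is not listed: it is automatic for finite Borel measures here.
\<close>

definition is_self_similar_measure ::
    "nat \<Rightarrow> (nat \<Rightarrow> real^'n \<Rightarrow> real^'n) \<Rightarrow> (nat \<Rightarrow> real) \<Rightarrow> (real^'n) measure \<Rightarrow> bool"
  where "is_self_similar_measure L S \<mu> \<M> \<longleftrightarrow>
    prob_space \<M> \<and> sets \<M> = sets borel \<and>
    (\<exists>c r. 0 < r \<and> (\<forall>l\<in>{1..L}. S l ` cball c r \<subseteq> cball c r) \<and> measure \<M> (cball c r) = 1) \<and>
    (\<forall>B\<in>sets borel. measure \<M> B = (\<Sum>l\<in>{1..L}. \<mu> l * measure \<M> (S l -` B)))"


section \<open>Words and the sets \<open>\<L>\<^sub>h\<close>\<close>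

definition word_map :: "(nat \<Rightarrow> 'a \<Rightarrow> 'a) \<Rightarrow> nat list \<Rightarrow> 'a \<Rightarrow> 'a"
  where "word_map S m = foldr (\<circ>) (map S m) id"

definition word_prod :: "(nat \<Rightarrow> real) \<Rightarrow> nat list \<Rightarrow> real"
  where "word_prod \<rho> m = prod_list (map \<rho> m)"

text \<open>The argument \<open>d\<close> stands for the diameter of the attractor.\<close>

definition coarse_words :: "(nat \<Rightarrow> real) \<Rightarrow> real \<Rightarrow> real \<Rightarrow> nat list set \<Rightarrow> nat list set"
  where "coarse_words \<rho> d h W = {m \<in> W. word_prod \<rho> m * d > h}"

primrec word_level :: "nat \<Rightarrow> (nat \<Rightarrow> real) \<Rightarrow> real \<Rightarrow> real \<Rightarrow> nat \<Rightarrow> nat list set"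
  where
    "word_level L \<rho> d h 0 = {[]}"
  | "word_level L \<rho> d h (Suc q) =
       (word_level L \<rho> d h q - coarse_words \<rho> d h (word_level L \<rho> d h q)) \<union>
       {m @ [l] | m l. m \<in> coarse_words \<rho> d h (word_level L \<rho> d h q) \<and> l \<in> {1..L}}"

text \<open>The eventual value exists as soon as \<open>h > 0\<close> and \<open>0 \<le> \<rho> l < 1\<close> for all \<open>l \<in> {1..L}\<close>.\<close>

definition stationary_words :: "nat \<Rightarrow> (nat \<Rightarrow> real) \<Rightarrow> real \<Rightarrow> real \<Rightarrow> nat list set"
  where "stationary_words L \<rho> d h = (THE W. \<forall>\<^sub>F q in sequentially. word_level L \<rho> d h q = W)"

definition refined_set :: "(nat \<Rightarrow> 'a \<Rightarrow> 'a) \<Rightarrow> nat list set \<Rightarrow> 'a set \<Rightarrow> 'a set"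
  where "refined_set S W K = (\<Union>m\<in>W. word_map S m ` K)"


section \<open>Polynomial spaces and cubatures\<close>

text \<open>Polynomials are identified with polynomial functions, in the real vector space of functions.\<close>

global_interpretation real_fun: vector_space "\<lambda>(c::real) (f::'a \<Rightarrow> real) x. c * f x"
  by unfold_locales (auto simp: fun_eq_iff algebra_simps)

definition monomial_fun :: "('n \<Rightarrow> nat) \<Rightarrow> real^'n \<Rightarrow> real"
  where "monomial_fun \<alpha> x = (\<Prod>i\<in>UNIV. (x $ i) ^ \<alpha> i)"

definition poly_space :: "nat \<Rightarrow> (real^'n \<Rightarrow> real) set"
  where "poly_space k = real_fun.span {monomial_fun \<alpha> | \<alpha>. (\<Sum>i\<in>UNIV. \<alpha> i) \<le> k}"

text \<open>Injectivity of the evaluation map forces \<open>P\<close> to be finite-dimensional.\<close>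

definition unisolvent :: "nat \<Rightarrow> (nat \<Rightarrow> real^'n) \<Rightarrow> (real^'n \<Rightarrow> real) set \<Rightarrow> bool"
  where "unisolvent M x P \<longleftrightarrow>
    real_fun.subspace P \<and> (\<forall>p\<in>P. real_polynomial_function p) \<and> real_fun.dim P = M \<and>
    inj_on (\<lambda>p. \<lambda>i\<in>{1..M}. p (x i)) P"

definition cubature :: "nat \<Rightarrow> (nat \<Rightarrow> real) \<Rightarrow> (nat \<Rightarrow> real^'n) \<Rightarrow> (real^'n \<Rightarrow> real) \<Rightarrow> real"
  where "cubature M w x f = (\<Sum>i\<in>{1..M}. w i * f (x i))"

definition refined_cubature ::
    "(nat \<Rightarrow> real^'n \<Rightarrow> real^'n) \<Rightarrow> (nat \<Rightarrow> real) \<Rightarrow> nat list set \<Rightarrow>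
     nat \<Rightarrow> (nat \<Rightarrow> real) \<Rightarrow> (nat \<Rightarrow> real^'n) \<Rightarrow> (real^'n \<Rightarrow> real) \<Rightarrow> real"
  where "refined_cubature S \<mu> W M w x f =
    (\<Sum>m\<in>W. word_prod \<mu> m * cubature M w x (f \<circ> word_map S m))"


section \<open>Partial derivatives and the class \<open>C\<^sup>k\<close>\<close>

definition partial_deriv :: "'n::finite \<Rightarrow> (real^'n \<Rightarrow> real) \<Rightarrow> real^'n \<Rightarrow> real"
  where "partial_deriv i f x = frechet_derivative f (at x) (axis i 1)"

text \<open>For open \<open>U\<close>.\<close>

primrec C_k_on :: "nat \<Rightarrow> (real^'n \<Rightarrow> real) \<Rightarrow> (real^'n) set \<Rightarrow> bool"
  where
    "C_k_on 0 f U \<longleftrightarrow> continuous_on U f"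
  | "C_k_on (Suc k) f U \<longleftrightarrow>
       (\<forall>x\<in>U. f differentiable (at x)) \<and> (\<forall>i. C_k_on k (partial_deriv i f) U)"

definition C_k_near :: "nat \<Rightarrow> (real^'n \<Rightarrow> real) \<Rightarrow> (real^'n) set \<Rightarrow> bool"
  where "C_k_near k f F \<longleftrightarrow> (\<exists>U. open U \<and> F \<subseteq> U \<and> C_k_on k f U)"

definition multi_indices :: "nat \<Rightarrow> ('n::finite \<Rightarrow> nat) set"
  where "multi_indices k = {\<beta>. (\<Sum>i\<in>UNIV. \<beta> i) = k}"

text \<open>
  The index type carries no order, so the successive partial derivatives are taken in an
  arbitrary order; by Schwarz's theorem the order does not matter wherever the function is
  of class \<open>C\<^sup>k\<close> with \<open>k\<close> the order of \<open>\<beta>\<close>.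
\<close>

definition multi_deriv :: "('n::finite \<Rightarrow> nat) \<Rightarrow> (real^'n \<Rightarrow> real) \<Rightarrow> real^'n \<Rightarrow> real"
  where "multi_deriv \<beta> f = foldr partial_deriv (SOME is. \<forall>i. count_list is i = \<beta> i) f"

text \<open>
  The \<open>L\<^sup>\<infinity>\<close> norm of a continuous function is its supremum. An essential supremum for
  Lebesgue measure would be wrong: the sets concerned may be Lebesgue null.
\<close>

definition sup_norm_on :: "'a set \<Rightarrow> ('a \<Rightarrow> real) \<Rightarrow> real"
  where "sup_norm_on F g = (SUP x\<in>F. \<bar>g x\<bar>)"

definition deriv_norm :: "nat \<Rightarrow> (real^'n) set \<Rightarrow> (real^'n \<Rightarrow> real) \<Rightarrow> real"
  where "deriv_norm k F f = Max ((\<lambda>\<beta>. sup_norm_on F (multi_deriv \<beta> f)) ` multi_indices k)"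

end

(*
  On the cell of a word m in L_h, f composed with S_m is approximated by the Taylor polynomial of f
  at a point of S_m(K), pulled back by the affine map S_m. It has degree at most k, so the cubature
  is exact on it, and by convexity of S_m(K), whose diameter is at most h diam K / diam Gamma,
  the Taylor remainder only involves derivatives of f on F_H. Iterating the self-similarity of mu
  along L_h splits the integral of f into the same cells, with total weight 1.
*)
theory Submission
  imports Defs "HOL-Combinatorics.Multiset_Permutations"
begin

section \<open>Iterated partial derivatives and Taylor expansion\<close>

text \<open>Three points shape the work. The norm \<open>deriv_norm\<close> is built from real
  suprema, which are informative only over bounded sets, yet \<open>F\<close> is a union over
  infinitely many scales and need not be closed; boundedness of the derivatives on \<open>F\<close>
  has to be proved, through a compact set between \<open>F\<close> and the open set on which
  \<open>f\<close> is smooth. The derivative \<open>multi_deriv\<close> differentiates in an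
  unspecified order, so Schwarz's theorem is needed to compare it with the derivatives that occur
  along a segment. The measure is assumed to be concentrated only on an invariant ball;
  concentration on \<Gamma> is derived, because all integrals are taken over \<Gamma>. The factor
  |w|_1 + 1 comes from inserting the Taylor polynomial: the cubature amplifies the remainder by at
  most |w|_1, the integral by at most 1. The sum of 1/\<beta>! equals n^(k+1)/(k+1)!, where n^(k+1)
  counts the coordinate words of length k+1, one for each term of the remainder.\<close>

lemma has_real_derivative_along_line:
  fixes g :: "real^'n \<Rightarrow> real"
  assumes "g differentiable (at (x + t *\<^sub>R v))"
  shows "((\<lambda>t. g (x + t *\<^sub>R v)) has_real_derivative
           frechet_derivative g (at (x + t *\<^sub>R v)) v) (at t)"
proof -
  let ?D = "frechet_derivative g (at (x + t *\<^sub>R v))"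
  have D: "(g has_derivative ?D) (at (x + t *\<^sub>R v))"
    using assms frechet_derivative_works by blast
  have line: "((\<lambda>t. x + t *\<^sub>R v) has_derivative (\<lambda>s. s *\<^sub>R v)) (at t)"
    by (auto intro!: derivative_eq_intros)
  have "((\<lambda>t. g (x + t *\<^sub>R v)) has_derivative (\<lambda>s. ?D (s *\<^sub>R v))) (at t)"
    using has_derivative_compose[OF line D] by simp
  moreover have "linear ?D"
    using D has_derivative_linear by blast
  ultimately show ?thesis
    by (simp add: has_field_derivative_def linear_cmul mult_commute_abs)
qed

lemma frechet_derivative_eq_sum_partial_deriv:
  fixes g :: "real^'n \<Rightarrow> real"
  assumes "g differentiable (at x)"
  shows "frechet_derivative g (at x) v = (\<Sum>i\<in>UNIV. v $ i * partial_deriv i g x)"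
proof -
  have lin: "linear (frechet_derivative g (at x))"
    using assms linear_frechet_derivative by blast
  have "frechet_derivative g (at x) v = frechet_derivative g (at x) (\<Sum>i\<in>UNIV. v $ i *s axis i 1)"
    by (simp add: basis_expansion)
  also have "\<dots> = (\<Sum>i\<in>UNIV. v $ i * partial_deriv i g x)"
    using lin by (simp add: linear_sum linear_cmul scalar_mult_eq_scaleR partial_deriv_def)
  finally show ?thesis .
qed

text \<open>The derivative at a point depends only on the germ there. This lets identities known
  only on the open set \<open>U\<close> be carried under a further
  \<open>partial_deriv\<close>.\<close>

lemma partial_deriv_cong_open:
  assumes "open U" "x \<in> U" "\<And>y. y \<in> U \<Longrightarrow> f y = g y"
  shows "partial_deriv i f x = partial_deriv i g x"
proof -
  have "(f has_derivative D) (at x) \<longleftrightarrow> (g has_derivative D) (at x)" for D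
    using assms by (metis has_derivative_transform_within_open)
  then show ?thesis
    by (simp add: partial_deriv_def frechet_derivative_def)
qed

section \<open>Classes C^k and the symmetry of mixed partial derivatives\<close>

lemma C_k_on_imp_continuous_on: "C_k_on k f U \<Longrightarrow> continuous_on U f"
  by (cases k) (auto intro!: continuous_at_imp_continuous_on differentiable_imp_continuous_within)

lemma C_k_on_Suc_imp: "C_k_on (Suc k) f U \<Longrightarrow> C_k_on k f U"
  by (induction k arbitrary: f)
     (auto intro!: continuous_at_imp_continuous_on differentiable_imp_continuous_within)

lemma C_k_on_mono:
  assumes "C_k_on k f U" "j \<le> k"
  shows "C_k_on j f U"
  using assms(2,1) by (induction rule: inc_induct) (blast intro: C_k_on_Suc_imp)+

text \<open>Reverse induction, because \<open>C_k_on\<close> unfolds at the derivative applied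
  first, and under \<open>foldr\<close> that is the last letter of the word.\<close>

lemma C_k_on_foldr_partial_deriv:
  "C_k_on (length is + k) f U \<Longrightarrow> C_k_on k (foldr partial_deriv is f) U"
proof (induction "is" arbitrary: f rule: rev_induct)
  case (snoc i "is")
  then show ?case by simp
qed simp

text \<open>The mean value theorem is used twice, once along each axis. Up to rearrangement the
  second difference is symmetric in \<open>i\<close> and \<open>j\<close>, so it can be compared
  with either mixed derivative.\<close>

lemma second_difference_mean_value:
  fixes g :: "real^'n \<Rightarrow> real"
  assumes g: "\<And>y. y \<in> U \<Longrightarrow> g differentiable (at y)"
    and gi: "\<And>y. y \<in> U \<Longrightarrow> partial_deriv i g differentiable (at y)"
    and s: "0 < s" and ball: "cball x (2 * s) \<subseteq> U"
  obtains p where "dist x p \<le> 2 * s"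
    and "g (x + s *\<^sub>R axis i 1 + s *\<^sub>R axis j 1) - g (x + s *\<^sub>R axis i 1)
           - g (x + s *\<^sub>R axis j 1) + g x
         = s * s * partial_deriv j (partial_deriv i g) p"
proof -
  let ?i = "axis i 1 :: real^'n" and ?j = "axis j 1 :: real^'n"
  have near: "dist x (x + t *\<^sub>R ?i + u *\<^sub>R ?j) \<le> 2 * s"
    if "0 \<le> t" "t \<le> s" "0 \<le> u" "u \<le> s" for t u
  proof -
    have "dist x (x + t *\<^sub>R ?i + u *\<^sub>R ?j) = norm (t *\<^sub>R ?i + u *\<^sub>R ?j)"
      using dist_add_cancel[of x 0 "t *\<^sub>R ?i + u *\<^sub>R ?j"] by (simp add: add.assoc)
    also have "\<dots> \<le> t + u"
      using that by (intro norm_triangle_le) (simp add: norm_axis_1)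
    finally show ?thesis using that by linarith
  qed
  then have inU: "x + t *\<^sub>R ?i + u *\<^sub>R ?j \<in> U"
    if "0 \<le> t" "t \<le> s" "0 \<le> u" "u \<le> s" for t u
    using that ball by (meson mem_cball subsetD)
  \<comment> \<open>First difference in direction \<open>j\<close>, as a function of the
    displacement along \<open>i\<close>; then \<open>\<phi> s - \<phi> 0\<close> is the second
    difference.\<close>
  define \<phi> where "\<phi> t = g ((x + s *\<^sub>R ?j) + t *\<^sub>R ?i) - g (x + t *\<^sub>R ?i)" for t
  define \<phi>' where "\<phi>' t = partial_deriv i g ((x + s *\<^sub>R ?j) + t *\<^sub>R ?i)
      - partial_deriv i g (x + t *\<^sub>R ?i)" for t
  have "(\<phi> has_real_derivative \<phi>' t) (at t)" if "0 \<le> t" "t \<le> s" for t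
  proof -
    have "x + s *\<^sub>R ?j + t *\<^sub>R ?i \<in> U" "x + t *\<^sub>R ?i \<in> U"
      using inU[of t s] inU[of t 0] that s by (simp_all add: add_ac)
    then show ?thesis
      unfolding \<phi>_def \<phi>'_def partial_deriv_def
      by (intro DERIV_diff has_real_derivative_along_line g)
  qed
  then obtain t where t: "0 < t" "t < s" "\<phi> s - \<phi> 0 = s * \<phi>' t"
    using MVT2[of 0 s \<phi> \<phi>'] s by auto
  have "((\<lambda>u. partial_deriv i g ((x + t *\<^sub>R ?i) + u *\<^sub>R ?j)) has_real_derivative
          partial_deriv j (partial_deriv i g) ((x + t *\<^sub>R ?i) + u *\<^sub>R ?j)) (at u)"
    if "0 \<le> u" "u \<le> s" for u
    unfolding partial_deriv_def[of j "partial_deriv i g"]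
    using inU[of t u] that t by (intro has_real_derivative_along_line gi) simp
  then obtain u where u: "0 < u" "u < s"
    "partial_deriv i g ((x + t *\<^sub>R ?i) + s *\<^sub>R ?j) - partial_deriv i g ((x + t *\<^sub>R ?i) + 0 *\<^sub>R ?j)
       = s * partial_deriv j (partial_deriv i g) ((x + t *\<^sub>R ?i) + u *\<^sub>R ?j)"
    using MVT2[of 0 s "\<lambda>u. partial_deriv i g ((x + t *\<^sub>R ?i) + u *\<^sub>R ?j)"
        "\<lambda>u. partial_deriv j (partial_deriv i g) ((x + t *\<^sub>R ?i) + u *\<^sub>R ?j)"] s by auto
  have "\<phi>' t = s * partial_deriv j (partial_deriv i g) (x + t *\<^sub>R ?i + u *\<^sub>R ?j)"
    using u(3) by (simp add: \<phi>'_def algebra_simps)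
  then have "\<phi> s - \<phi> 0 = s * s * partial_deriv j (partial_deriv i g) (x + t *\<^sub>R ?i + u *\<^sub>R ?j)"
    using t by simp
  then show ?thesis
    using that[of "x + t *\<^sub>R ?i + u *\<^sub>R ?j"] near[of t u] t u
    by (simp add: \<phi>_def algebra_simps)
qed

text \<open>The second difference equals \<open>s * s\<close> times one mixed derivative at
  \<open>p\<close> and \<open>s * s\<close> times the other at \<open>q\<close>. Both points are
  close to \<open>x\<close>, so a gap between the mixed derivatives at \<open>x\<close> would
  contradict their continuity.\<close>

lemma partial_deriv_commute:
  fixes g :: "real^'n \<Rightarrow> real"
  assumes U: "open U" and g: "C_k_on (Suc (Suc k)) g U" and x: "x \<in> U"
  shows "partial_deriv i (partial_deriv j g) x = partial_deriv j (partial_deriv i g) x"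
proof (rule ccontr)
  let ?a = "partial_deriv i (partial_deriv j g)" and ?b = "partial_deriv j (partial_deriv i g)"
  assume "?a x \<noteq> ?b x"
  \<comment> \<open>Half the gap, so that two errors below \<open>e\<close> cannot bridge
    it.\<close>
  define e where "e = \<bar>?a x - ?b x\<bar> / 2"
  have e: "0 < e" using \<open>?a x \<noteq> ?b x\<close> by (simp add: e_def)
  have cont: "continuous_on U ?a" "continuous_on U ?b"
    using g by (auto intro!: C_k_on_imp_continuous_on[of k])
  then have "isCont ?a x" "isCont ?b x"
    using U x by (simp_all add: continuous_on_eq_continuous_at)
  then obtain da db where d: "0 < da" "\<And>y. dist y x < da \<Longrightarrow> dist (?a y) (?a x) < e"
    "0 < db" "\<And>y. dist y x < db \<Longrightarrow> dist (?b y) (?b x) < e"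
    unfolding continuous_at_eps_delta using e by metis
  obtain r where r: "0 < r" "cball x r \<subseteq> U"
    using U x open_contains_cball by blast
  \<comment> \<open>The divisor 3 keeps \<open>p\<close> and \<open>q\<close>, which may be at
    distance \<open>2 * s\<close> from \<open>x\<close>, strictly within both continuity radii and
    within \<open>U\<close>.\<close>
  define s where "s = min r (min da db) / 3"
  have s: "0 < s" "2 * s < da" "2 * s < db" "2 * s \<le> r"
    using r d by (auto simp: s_def)
  then have ball: "cball x (2 * s) \<subseteq> U" using r by force
  obtain p where p: "dist x p \<le> 2 * s"
    "g (x + s *\<^sub>R axis j 1 + s *\<^sub>R axis i 1) - g (x + s *\<^sub>R axis j 1)
           - g (x + s *\<^sub>R axis i 1) + g x = s * s * ?a p"
    using second_difference_mean_value[of U g j s x i] g s ball by auto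
  obtain q where q: "dist x q \<le> 2 * s"
    "g (x + s *\<^sub>R axis i 1 + s *\<^sub>R axis j 1) - g (x + s *\<^sub>R axis i 1)
           - g (x + s *\<^sub>R axis j 1) + g x = s * s * ?b q"
    using second_difference_mean_value[of U g i s x j] g s ball by auto
  have "s * s * ?a p = s * s * ?b q"
    using p(2) q(2) by (simp add: algebra_simps)
  then have "?a p = ?b q" using s by simp
  moreover have "dist (?a p) (?a x) < e" "dist (?b q) (?b x) < e"
    using p(1) q(1) s by (auto intro!: d simp: dist_commute)
  ultimately have "dist (?a x) (?b x) < 2 * e"
    using dist_triangle3[of "?a x" "?b x" "?a p"] by simp
  moreover have "dist (?a x) (?b x) = 2 * e"
    by (simp add: dist_real_def e_def)
  ultimately show False by simp
qed

text \<open>The letter \<open>i\<close> passes one letter of \<open>us\<close> at a time. Each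
  exchange applies symmetry to a function already differentiated along all the letters behind the
  pair, which still has the two orders of smoothness that symmetry requires.\<close>

lemma foldr_partial_deriv_move:
  assumes U: "open U" and "C_k_on (length (us @ i # vs)) f U" and "x \<in> U"
  shows "foldr partial_deriv (us @ i # vs) f x = foldr partial_deriv (i # us @ vs) f x"
  using assms(2,3)
proof (induction us arbitrary: x)
  case (Cons u us)
  have IH: "foldr partial_deriv (us @ i # vs) f y = foldr partial_deriv (i # us @ vs) f y"
    if "y \<in> U" for y
    using Cons.IH[OF C_k_on_Suc_imp that] Cons.prems(1) by simp
  have "C_k_on (length (us @ vs) + Suc (Suc 0)) f U"
    using Cons.prems(1) by simp
  then have C: "C_k_on (Suc (Suc 0)) (foldr partial_deriv (us @ vs) f) U"
    by (rule C_k_on_foldr_partial_deriv)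
  have "foldr partial_deriv ((u # us) @ i # vs) f x
      = partial_deriv u (foldr partial_deriv (us @ i # vs) f) x" by simp
  also have "\<dots> = partial_deriv u (partial_deriv i (foldr partial_deriv (us @ vs) f)) x"
    by (rule partial_deriv_cong_open[OF U Cons.prems(2)]) (use IH in simp)
  also have "\<dots> = partial_deriv i (partial_deriv u (foldr partial_deriv (us @ vs) f)) x"
    by (rule partial_deriv_commute[OF U C Cons.prems(2)])
  finally show ?case by simp
qed simp

text \<open>A selection argument: the first letter of one word is located in the other and moved to
  its front; what remains of the two words is again a pair of rearrangements.\<close>

lemma foldr_partial_deriv_perm:
  assumes U: "open U" and "C_k_on (length is) f U" and "mset is = mset js" and "x \<in> U"
  shows "foldr partial_deriv is f x = foldr partial_deriv js f x"
  using assms(2-4)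
proof (induction "is" arbitrary: js x)
  case (Cons i "is")
  have "i \<in> set js"
    using Cons.prems(2) by (metis list.set_intros(1) mset_eq_setD)
  then obtain us vs where js: "js = us @ i # vs"
    by (meson split_list)
  have perm: "mset is = mset (us @ vs)" and len: "length (i # is) = length js"
    using Cons.prems(2) js by (simp, blast dest: mset_eq_length)
  have IH: "foldr partial_deriv is f y = foldr partial_deriv (us @ vs) f y" if "y \<in> U" for y
    using Cons.IH[OF C_k_on_Suc_imp perm that] Cons.prems(1) by simp
  have "foldr partial_deriv (i # is) f x = foldr partial_deriv (i # us @ vs) f x"
    using partial_deriv_cong_open[OF U Cons.prems(3) IH] by simp
  also have "\<dots> = foldr partial_deriv js f x"
    using foldr_partial_deriv_move[of U us i vs f x] U Cons.prems js len by simp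
  finally show ?case .
qed simp

section \<open>Coordinate words and the multi-indices that count their letters\<close>

lemma exists_list_with_counts:
  fixes \<beta> :: "'n::finite \<Rightarrow> nat"
  shows "\<exists>is. count_list is = \<beta>"
proof -
  obtain "is" where "mset is = Abs_multiset \<beta>"
    using ex_mset by blast
  then have "count_list is = count (Abs_multiset \<beta>)"
    by (simp add: fun_eq_iff flip: count_mset)
  then show ?thesis
    by (metis count_Abs_multiset finite)
qed

lemma sum_count_list: "(\<Sum>i\<in>UNIV. count_list is i) = length (is :: 'n::finite list)"
  by (rule sum_count_set) auto

text \<open>The word chosen by \<open>SOME\<close> in \<open>multi_deriv\<close> is a rearrangement
  of \<open>is\<close>, so it yields the same derivative where \<open>f\<close> is smooth
  enough.\<close>

lemma foldr_partial_deriv_eq_multi_deriv: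
  fixes "is" :: "'n::finite list"
  assumes U: "open U" and f: "C_k_on (length is) f U" and x: "x \<in> U"
  shows "foldr partial_deriv is f x = multi_deriv (count_list is) f x"
proof -
  define js where "js = (SOME js. \<forall>i. count_list js i = count_list is i)"
  have "\<forall>i. count_list js i = count_list is i"
    unfolding js_def by (rule someI[where x = "is"]) simp
  then have "mset is = mset js"
    by (simp add: multiset_eq_iff flip: count_mset)
  then show ?thesis
    using foldr_partial_deriv_perm[OF U f _ x] by (simp add: multi_deriv_def flip: js_def)
qed

lemma continuous_on_multi_deriv:
  fixes f :: "real^'n \<Rightarrow> real"
  assumes U: "open U" and f: "C_k_on k f U" and \<beta>: "\<beta> \<in> multi_indices k"
  shows "continuous_on U (multi_deriv \<beta> f)"
proof -
  obtain "is" where "is": "count_list is = \<beta>"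
    using exists_list_with_counts by blast
  then have len: "length is = k"
    using \<beta> sum_count_list[of "is"] by (simp add: multi_indices_def)
  have "continuous_on U (foldr partial_deriv is f)"
    using C_k_on_foldr_partial_deriv[of "is" 0] f len by simp
  then show ?thesis
    using foldr_partial_deriv_eq_multi_deriv[OF U] f len "is"
    by (metis (no_types, lifting) continuous_on_cong)
qed

text \<open>
  Indexing the iterated derivatives along a segment by words of coordinates rather than by
  multi-indices makes the differentiation step a mere prefixing of a letter.
\<close>

definition line_deriv :: "nat \<Rightarrow> (real^'n \<Rightarrow> real) \<Rightarrow> real^'n \<Rightarrow> real^'n \<Rightarrow> real"
  where "line_deriv m f v y =
    (\<Sum>is\<in>{is. length is = m}. prod_list (map (($) v) is) * foldr partial_deriv is f y)"

lemma finite_lists_of_length [simp]: "finite {is :: 'n::finite list. length is = m}"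
  using finite_lists_length_eq[of "UNIV :: 'n set" m] by simp

lemma lists_length_Suc_bij:
  "bij_betw (\<lambda>(i, is). i # is) (UNIV \<times> {is. length is = m}) {is. length is = Suc m}"
  by (rule bij_betwI[where g = "\<lambda>is. (hd is, tl is)"]) (auto simp: length_Suc_conv)

text \<open>The first letter of a word is the derivative applied last. Splitting it off leaves, for
  each shorter word, the sum that the chain rule gives for a derivative in direction
  \<open>v\<close>.\<close>

lemma line_deriv_Suc:
  "line_deriv (Suc m) f v y =
    (\<Sum>is\<in>{is. length is = m}. prod_list (map (($) v) is) *
       (\<Sum>i\<in>UNIV. v $ i * partial_deriv i (foldr partial_deriv is f) y))"
proof -
  have "line_deriv (Suc m) f v y =
      (\<Sum>(i, is)\<in>UNIV \<times> {is. length is = m}. prod_list (map (($) v) (i # is)) *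
         foldr partial_deriv (i # is) f y)"
    unfolding line_deriv_def
    by (subst sum.reindex_bij_betw[OF lists_length_Suc_bij, symmetric])
       (simp add: case_prod_unfold)
  also have "\<dots> = (\<Sum>i\<in>UNIV. \<Sum>is\<in>{is. length is = m}. prod_list (map (($) v) (i # is)) *
         foldr partial_deriv (i # is) f y)"
    by (simp add: sum.cartesian_product)
  also have "\<dots> = (\<Sum>is\<in>{is. length is = m}. \<Sum>i\<in>UNIV. prod_list (map (($) v) (i # is)) *
         foldr partial_deriv (i # is) f y)"
    by (rule sum.swap)
  finally show ?thesis
    by (simp add: sum_distrib_left mult_ac)
qed

lemma has_real_derivative_line_deriv:
  fixes f :: "real^'n \<Rightarrow> real"
  assumes f: "C_k_on (Suc m) f U" and U: "a + t *\<^sub>R v \<in> U"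
  shows "((\<lambda>t. line_deriv m f v (a + t *\<^sub>R v)) has_real_derivative
           line_deriv (Suc m) f v (a + t *\<^sub>R v)) (at t)"
proof -
  have "((\<lambda>t. foldr partial_deriv is f (a + t *\<^sub>R v)) has_real_derivative
      (\<Sum>i\<in>UNIV. v $ i * partial_deriv i (foldr partial_deriv is f) (a + t *\<^sub>R v))) (at t)"
    if "length is = m" for "is"
  proof -
    have "C_k_on (Suc 0) (foldr partial_deriv is f) U"
      by (rule C_k_on_foldr_partial_deriv) (use f that in simp)
    then have "foldr partial_deriv is f differentiable (at (a + t *\<^sub>R v))"
      using U by simp
    then show ?thesis
      using has_real_derivative_along_line[of "foldr partial_deriv is f" a t v]
      by (simp add: frechet_derivative_eq_sum_partial_deriv)
  qed
  then show ?thesis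
    unfolding line_deriv_Suc unfolding line_deriv_def
    by (intro DERIV_sum DERIV_cmult) blast
qed

text \<open>Maclaurin's formula with Lagrange remainder for \<open>f\<close> restricted to the
  segment, parametrised over [0,1] and evaluated at 1.\<close>

lemma Taylor_along_segment:
  fixes f :: "real^'n \<Rightarrow> real"
  assumes f: "C_k_on (Suc k) f U" and seg: "closed_segment a y \<subseteq> U"
  obtains \<xi> where "\<xi> \<in> closed_segment a y"
    and "f y = (\<Sum>m\<le>k. line_deriv m f (y - a) a / fact m)
                 + line_deriv (Suc k) f (y - a) \<xi> / fact (Suc k)"
proof -
  have seg_pt: "a + t *\<^sub>R (y - a) \<in> closed_segment a y" if "0 \<le> t" "t \<le> 1" for t
    using that by (auto simp: in_segment algebra_simps intro!: exI[of _ t])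
  have line0: "line_deriv 0 f (y - a) z = f z" for z
    by (simp add: line_deriv_def)
  define D where "D m t = line_deriv m f (y - a) (a + t *\<^sub>R (y - a))" for m t
  have "\<forall>m t. m < Suc k \<and> 0 \<le> t \<and> t \<le> 1 \<longrightarrow> DERIV (D m) t :> D (Suc m) t"
    unfolding D_def using seg_pt seg C_k_on_mono[OF f]
    by (intro allI impI has_real_derivative_line_deriv[where U = U])
       (auto simp del: C_k_on.simps)
  then obtain t where t: "0 < t" "t < 1"
    "D 0 1 = (\<Sum>m<Suc k. D m 0 / fact m * 1 ^ m) + D (Suc k) t / fact (Suc k) * 1 ^ Suc k"
    using Maclaurin[of 1 "Suc k" D "D 0"] by auto
  show ?thesis
  proof (rule that[of "a + t *\<^sub>R (y - a)"])
    show "f y = (\<Sum>m\<le>k. line_deriv m f (y - a) a / fact m)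
        + line_deriv (Suc k) f (y - a) (a + t *\<^sub>R (y - a)) / fact (Suc k)"
      using t(3) by (simp add: D_def line0 lessThan_Suc_atMost del: sum.lessThan_Suc)
  qed (use seg_pt t in auto)
qed

section \<open>Multi-indices and polynomial spaces\<close>

lemma multi_indices_eq_image_count_list:
  "multi_indices m = (count_list ` {is. length is = m} :: ('n::finite \<Rightarrow> nat) set)"
proof (intro equalityI subsetI)
  fix \<beta> :: "'n \<Rightarrow> nat"
  assume \<beta>: "\<beta> \<in> multi_indices m"
  obtain "is" where "count_list is = \<beta>"
    using exists_list_with_counts by blast
  then show "\<beta> \<in> count_list ` {is. length is = m}"
    using \<beta> sum_count_list[of "is"] by (auto simp: multi_indices_def)
qed (auto simp: multi_indices_def sum_count_list)

lemma finite_multi_indices [simp]: "finite (multi_indices m :: ('n::finite \<Rightarrow> nat) set)"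
  by (simp add: multi_indices_eq_image_count_list)

lemma multi_indices_nonempty: "multi_indices m \<noteq> ({} :: ('n::finite \<Rightarrow> nat) set)"
  unfolding multi_indices_eq_image_count_list using Ex_list_of_length by auto

text \<open>This is the multinomial coefficient: the words with letter counts \<beta> are the
  rearrangements of a single multiset.\<close>

lemma card_lists_with_counts:
  fixes \<beta> :: "'n::finite \<Rightarrow> nat"
  assumes "\<beta> \<in> multi_indices m"
  shows "card {is. count_list is = \<beta>} * (\<Prod>i\<in>UNIV. fact (\<beta> i)) = fact m"
proof -
  obtain js where js: "length js = m" "count_list js = \<beta>"
    using assms by (auto simp: multi_indices_eq_image_count_list)
  have "{is. count_list is = \<beta>} = permutations_of_multiset (mset js)"
    by (auto simp: permutations_of_multiset_def multiset_eq_iff count_mset fun_eq_iff js(2)[symmetric])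
  \<comment> \<open>Absent letters contribute \<open>fact 0 = 1\<close>, so only the support of the
    multiset matters.\<close>
  moreover have "(\<Prod>i\<in>UNIV. fact (\<beta> i) :: nat) = (\<Prod>i\<in>set_mset (mset js). fact (count (mset js) i))"
    by (rule prod.mono_neutral_cong_right) (auto simp: count_mset js(2)[symmetric])
  ultimately show ?thesis
    using card_permutations_of_multiset_aux[of "mset js"] js(1) by simp
qed

text \<open>Sorting the n^m words of length m by their letter counts gives fibres of size
  m!/\<beta>!, the multinomial theorem at (1,...,1). It turns a bound counted over words into the
  constant stated with multi-indices.\<close>

lemma sum_multi_indices_inverse_fact:
  "(\<Sum>\<beta>\<in>multi_indices m. 1 / (\<Prod>i\<in>(UNIV::'n::finite set). fact (\<beta> i)))
     = real CARD('n) ^ m / fact m"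
proof -
  have fib: "real (card {is. count_list is = \<beta>}) = fact m * (1 / (\<Prod>i\<in>UNIV. fact (\<beta> i)))"
    if "\<beta> \<in> multi_indices m" for \<beta> :: "'n \<Rightarrow> nat"
  proof -
    have "real (card {is. count_list is = \<beta>}) * (\<Prod>i\<in>UNIV. fact (\<beta> i)) = fact m"
      using arg_cong[OF card_lists_with_counts[OF that], of real] by simp
    moreover have "(\<Prod>i\<in>UNIV. fact (\<beta> i)) \<noteq> (0::real)" by simp
    ultimately show ?thesis by (simp add: field_simps)
  qed
  have len: "{is. length is = m \<and> count_list is = \<beta>} = {is. count_list is = \<beta>}"
    if "\<beta> \<in> multi_indices m" for \<beta> :: "'n \<Rightarrow> nat"
    using that by (auto simp: multi_indices_def sum_count_list)
  have "real CARD('n) ^ m = real (card {is :: 'n list. length is = m})"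
    using card_lists_length_eq[of "UNIV :: 'n set" m] by simp
  also have "\<dots> = (\<Sum>is\<in>{is :: 'n list. length is = m}. 1)" by simp
  also have "\<dots> = (\<Sum>\<beta>\<in>multi_indices m. \<Sum>is\<in>{is \<in> {is :: 'n list. length is = m}. count_list is = \<beta>}. 1)"
    by (rule sum.group[symmetric]) (auto simp: multi_indices_eq_image_count_list)
  also have "\<dots> = (\<Sum>\<beta>\<in>multi_indices m. fact m * (1 / (\<Prod>i\<in>(UNIV :: 'n set). fact (\<beta> i))))"
    by (rule sum.cong) (simp_all add: len fib)
  also have "\<dots> = fact m * (\<Sum>\<beta>\<in>multi_indices m. 1 / (\<Prod>i\<in>(UNIV :: 'n set). fact (\<beta> i)))"
    by (simp only: sum_distrib_left)
  finally show ?thesis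
    by (metis nonzero_mult_div_cancel_left fact_nonzero)
qed

section \<open>Polynomial functions of bounded degree\<close>

lemma subspace_poly_space: "real_fun.subspace (poly_space k)"
  by (simp add: poly_space_def real_fun.subspace_span)

lemma poly_space_scale: "p \<in> poly_space k \<Longrightarrow> (\<lambda>y. c * p y) \<in> poly_space k"
  using real_fun.subspace_scale[OF subspace_poly_space] .

lemma poly_space_add: "p \<in> poly_space k \<Longrightarrow> q \<in> poly_space k \<Longrightarrow> (\<lambda>y. p y + q y) \<in> poly_space k"
  using real_fun.subspace_add[OF subspace_poly_space, of p k q] by (simp add: func_plus)

lemma poly_space_zero: "(\<lambda>y. 0) \<in> poly_space k"
  using real_fun.subspace_0[OF subspace_poly_space] by (simp add: func_zero)

lemma poly_space_sum:
  "(\<And>i. i \<in> I \<Longrightarrow> p i \<in> poly_space k) \<Longrightarrow> (\<lambda>y. \<Sum>i\<in>I. p i y) \<in> poly_space k"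
  by (induction I rule: infinite_finite_induct) (auto simp: poly_space_zero intro: poly_space_add)

lemma poly_space_mono: "j \<le> k \<Longrightarrow> poly_space j \<subseteq> poly_space k"
  unfolding poly_space_def by (rule real_fun.span_mono) auto

lemma monomial_fun_in_poly_space: "(\<Sum>i\<in>UNIV. \<alpha> i) \<le> k \<Longrightarrow> monomial_fun \<alpha> \<in> poly_space k"
  unfolding poly_space_def by (rule real_fun.span_base) auto

lemma poly_space_const: "(\<lambda>y. c) \<in> poly_space k"
  using poly_space_scale[OF monomial_fun_in_poly_space[of "\<lambda>_. 0"], of k c]
  by (simp add: monomial_fun_def)

lemma poly_space_component: "(\<lambda>y :: real^'n. y $ r) \<in> poly_space 1"
proof -
  have "(\<lambda>y :: real^'n. y $ r) = monomial_fun (\<lambda>i. if i = r then 1 else 0)"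
    by (simp add: monomial_fun_def fun_eq_iff if_distrib[of "power _"] prod.delta cong: if_cong)
  then show ?thesis
    by (simp add: monomial_fun_in_poly_space)
qed

text \<open>By bilinearity it is enough to multiply monomials, whose exponents add.\<close>

lemma poly_space_mult:
  fixes p q :: "real^'n \<Rightarrow> real"
  assumes p: "p \<in> poly_space j" and q: "q \<in> poly_space k"
  shows "(\<lambda>y. p y * q y) \<in> poly_space (j + k)"
proof -
  \<comment> \<open>Span induction needs a subspace, so one factor \<open>r\<close> is frozen: first
    a monomial, then, with the roles exchanged, \<open>p\<close> itself.\<close>
  have sub1: "real_fun.subspace {p. (\<lambda>y. p y * r y) \<in> poly_space m}"
    for r :: "real^'n \<Rightarrow> real" and m
    unfolding real_fun.subspace_def
    by (auto simp: func_plus func_zero distrib_right mult.assoc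
             intro: poly_space_zero poly_space_add poly_space_scale)
  have mono: "(\<lambda>y. monomial_fun \<alpha> y * monomial_fun \<beta> y) \<in> poly_space (j + k)"
    if "(\<Sum>i\<in>UNIV. \<alpha> i) \<le> j" "(\<Sum>i\<in>UNIV. \<beta> i) \<le> k" for \<alpha> \<beta> :: "'n \<Rightarrow> nat"
  proof -
    have "(\<lambda>y. monomial_fun \<alpha> y * monomial_fun \<beta> y) = monomial_fun (\<lambda>i. \<alpha> i + \<beta> i)"
      by (simp add: monomial_fun_def fun_eq_iff power_add prod.distrib)
    then show ?thesis
      using that by (simp add: monomial_fun_in_poly_space sum.distrib)
  qed
  have left: "(\<lambda>y. p y * monomial_fun \<beta> y) \<in> poly_space (j + k)"
    if "(\<Sum>i\<in>UNIV. \<beta> i) \<le> k" for \<beta> :: "'n \<Rightarrow> nat"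
    using p unfolding poly_space_def[of j]
    by (rule real_fun.span_induct[OF _ sub1]) (use mono that in auto)
  have "(\<lambda>y. q y * p y) \<in> poly_space (j + k)"
    using q unfolding poly_space_def[of k]
    by (rule real_fun.span_induct[OF _ sub1]) (use left in \<open>auto simp: mult.commute\<close>)
  then show ?thesis by (simp add: mult.commute)
qed

lemma poly_space_prod_list:
  "(\<And>i. i \<in> set is \<Longrightarrow> g i \<in> poly_space 1) \<Longrightarrow>
     (\<lambda>y. prod_list (map (\<lambda>i. g i y) is)) \<in> poly_space (length is)"
proof (induction "is")
  case (Cons i "is")
  then show ?case
    using poly_space_mult[of "g i" 1 "\<lambda>y. prod_list (map (\<lambda>i. g i y) is)" "length is"] by simp
qed (simp add: poly_space_const)

lemma poly_space_affine_component:
  fixes B :: "real^'n^'n"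
  shows "(\<lambda>y. (B *v y + c) $ i) \<in> poly_space 1"
  unfolding vector_add_component matrix_vector_mult_def vec_lambda_beta
  by (intro poly_space_add poly_space_sum poly_space_scale poly_space_component poly_space_const)

lemma continuous_on_poly_space: "p \<in> poly_space k \<Longrightarrow> continuous_on X p"
proof -
  have "real_fun.subspace {p. continuous_on X p}"
    unfolding real_fun.subspace_def by (auto simp: func_plus func_zero intro!: continuous_intros)
  then show "continuous_on X p" if "p \<in> poly_space k"
    using that unfolding poly_space_def
    by (elim real_fun.span_induct) (auto simp: monomial_fun_def[abs_def] intro!: continuous_intros)
qed

text \<open>An affine substitution does not raise the degree: a word of length \<open>m\<close>
  contributes a constant times a product of \<open>m\<close> affine coordinate functions. This makes
  exactness of the cubature applicable to the pulled-back Taylor polynomial.\<close>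

lemma Taylor_polynomial_in_poly_space:
  fixes B :: "real^'n^'n"
  shows "(\<lambda>y. \<Sum>m\<le>k. line_deriv m f (B *v y + c) a / fact m) \<in> poly_space k"
proof -
  have "(\<lambda>y. prod_list (map (($) (B *v y + c)) is)) \<in> poly_space k" if "length is \<le> k" for "is"
    using poly_space_prod_list[of "is" "\<lambda>i y. (B *v y + c) $ i"] poly_space_mono[OF that]
      poly_space_affine_component[of B c] by blast
  then have "(\<lambda>y. inverse (fact m) * (\<Sum>is\<in>{is. length is = m}. foldr partial_deriv is f a *
      prod_list (map (($) (B *v y + c)) is))) \<in> poly_space k" if "m \<le> k" for m
    using that by (intro poly_space_scale poly_space_sum) auto
  then show ?thesis
    unfolding line_deriv_def divide_inverse
    by (intro poly_space_sum) (simp add: mult.commute)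
qed

section \<open>Bounds for the Taylor remainder\<close>

lemma abs_prod_list_components_le:
  fixes v :: "real^'n"
  shows "\<bar>prod_list (map (($) v) is)\<bar> \<le> norm v ^ length is"
proof (induction "is")
  case (Cons i "is")
  then show ?case
    using mult_mono[OF component_le_norm_cart Cons.IH, of v i] by (simp add: abs_mult)
qed simp

lemma abs_line_deriv_le:
  fixes v :: "real^'n"
  assumes "\<And>is. length is = m \<Longrightarrow> \<bar>foldr partial_deriv is f y\<bar> \<le> D"
  shows "\<bar>line_deriv m f v y\<bar> \<le> real CARD('n) ^ m * (norm v ^ m * D)"
proof -
  have "\<bar>line_deriv m f v y\<bar> \<le> (\<Sum>is\<in>{is :: 'n list. length is = m}. norm v ^ m * D)"
    unfolding line_deriv_def
  proof (rule order_trans[OF sum_abs sum_mono])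
    fix "is" :: "'n list"
    assume "is \<in> {is. length is = m}"
    then show "\<bar>prod_list (map (($) v) is) * foldr partial_deriv is f y\<bar> \<le> norm v ^ m * D"
      using assms abs_prod_list_components_le[of v "is"] by (auto simp: abs_mult intro!: mult_mono)
  qed
  also have "\<dots> = real CARD('n) ^ m * (norm v ^ m * D)"
    using card_lists_length_eq[of "UNIV :: 'n set" m] by simp
  finally show ?thesis .
qed

text \<open>Boundedness is essential: a real \<open>SUP\<close> over an unbounded set is an
  arbitrary value and bounds nothing.\<close>

lemma abs_multi_deriv_le_deriv_norm:
  fixes f :: "real^'n \<Rightarrow> real"
  assumes "\<And>\<beta>. \<beta> \<in> multi_indices m \<Longrightarrow> bdd_above ((\<lambda>x. \<bar>multi_deriv \<beta> f x\<bar>) ` F)"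
    and "\<beta> \<in> multi_indices m" and "x \<in> F"
  shows "\<bar>multi_deriv \<beta> f x\<bar> \<le> deriv_norm m F f"
proof -
  have "\<bar>multi_deriv \<beta> f x\<bar> \<le> sup_norm_on F (multi_deriv \<beta> f)"
    unfolding sup_norm_on_def using assms by (intro cSUP_upper)
  also have "\<dots> \<le> deriv_norm m F f"
    unfolding deriv_norm_def using assms by (intro Max_ge) auto
  finally show ?thesis .
qed

text \<open>Once the segment lies in \<open>F\<close>, so does the Lagrange point. The norm over
  \<open>F\<close> therefore controls the remainder, although smoothness is given on the larger set
  \<open>U\<close>.\<close>

lemma Taylor_remainder_le:
  fixes f :: "real^'n \<Rightarrow> real"
  assumes U: "open U" and f: "C_k_on (Suc k) f U" and FU: "F \<subseteq> U"
    and seg: "closed_segment a y \<subseteq> F"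
    and bdd: "\<And>\<beta>. \<beta> \<in> multi_indices (Suc k) \<Longrightarrow> bdd_above ((\<lambda>x. \<bar>multi_deriv \<beta> f x\<bar>) ` F)"
  shows "\<bar>f y - (\<Sum>m\<le>k. line_deriv m f (y - a) a / fact m)\<bar>
     \<le> (\<Sum>\<beta>\<in>multi_indices (Suc k). 1 / (\<Prod>i\<in>(UNIV::'n set). fact (\<beta> i))) *
         norm (y - a) ^ Suc k * deriv_norm (Suc k) F f"
proof -
  obtain \<xi> where \<xi>: "\<xi> \<in> closed_segment a y"
    "f y = (\<Sum>m\<le>k. line_deriv m f (y - a) a / fact m)
        + line_deriv (Suc k) f (y - a) \<xi> / fact (Suc k)"
    using Taylor_along_segment[OF f order_trans[OF seg FU]] by blast
  have "\<xi> \<in> F" using \<xi> seg by blast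
  have *: "\<bar>foldr partial_deriv is f \<xi>\<bar> \<le> deriv_norm (Suc k) F f"
    if len: "length is = Suc k" for "is" :: "'n list"
  proof -
    have "foldr partial_deriv is f \<xi> = multi_deriv (count_list is) f \<xi>"
    proof (rule foldr_partial_deriv_eq_multi_deriv[OF U])
      show "C_k_on (length is) f U" using f len by (simp only:)
      show "\<xi> \<in> U" using FU \<open>\<xi> \<in> F\<close> by (rule subsetD)
    qed
    moreover have "count_list is \<in> multi_indices (Suc k)"
      using len by (auto simp: multi_indices_eq_image_count_list)
    ultimately show ?thesis
      using abs_multi_deriv_le_deriv_norm[OF bdd] \<open>\<xi> \<in> F\<close> by simp
  qed
  have "\<bar>line_deriv (Suc k) f (y - a) \<xi>\<bar>
      \<le> real CARD('n) ^ Suc k * (norm (y - a) ^ Suc k * deriv_norm (Suc k) F f)"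
    by (rule abs_line_deriv_le[OF *])
  then have "\<bar>line_deriv (Suc k) f (y - a) \<xi> / fact (Suc k)\<bar>
      \<le> real CARD('n) ^ Suc k * (norm (y - a) ^ Suc k * deriv_norm (Suc k) F f) / fact (Suc k)"
    unfolding abs_divide abs_of_nonneg[OF fact_ge_zero]
    by (rule divide_right_mono) (rule fact_ge_zero)
  moreover have "f y - (\<Sum>m\<le>k. line_deriv m f (y - a) a / fact m)
      = line_deriv (Suc k) f (y - a) \<xi> / fact (Suc k)"
    using \<xi>(2) by (simp only: add_diff_cancel_left')
  ultimately show ?thesis
    by (simp only: sum_multi_indices_inverse_fact times_divide_eq_left mult.assoc)
qed

section \<open>Integration against a self-similar measure\<close>

lemma self_similar_measureD:
  assumes "is_self_similar_measure L S \<mu> M"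
  shows "prob_space M" "sets M = sets borel" "space M = UNIV"
    and "B \<in> sets borel \<Longrightarrow> measure M B = (\<Sum>l\<in>{1..L}. \<mu> l * measure M (S l -` B))"
  using assms sets_eq_imp_space_eq[of M borel] by (auto simp: is_self_similar_measure_def)

text \<open>A nearest point of \<open>G\<close> is mapped into \<open>G\<close>, and its image is at
  most \<open>r\<close> times as far from \<open>T x\<close>.\<close>

lemma infdist_contraction_le:
  fixes T :: "'a::heine_borel \<Rightarrow> 'a"
  assumes "closed G" "G \<noteq> {}" "T ` G \<subseteq> G" and "\<And>y. dist (T x) (T y) \<le> r * dist x y"
  shows "infdist (T x) G \<le> r * infdist x G"
proof -
  obtain y where "y \<in> G" "infdist x G = dist x y"
    using infdist_attains_inf assms by blast
  then show ?thesis
    using infdist_le2[of "T y" G "T x" "r * dist x y"] assms by auto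
qed

text \<open>
  The sublevel set of the distance to \<open>G\<close> at \<open>t\<close> is mapped into the one at \<open>r * t\<close>, so
  self-similarity shows that all sublevel sets at \<open>r ^ q * t\<close> have full measure.
\<close>

lemma AE_self_similar_measure_attractor:
  fixes S :: "nat \<Rightarrow> real^'n \<Rightarrow> real^'n"
  assumes M: "is_self_similar_measure L S \<mu> M" and \<mu>: "(\<Sum>l\<in>{1..L}. \<mu> l) = 1"
    and S: "\<And>l. l \<in> {1..L} \<Longrightarrow> S l \<in> borel_measurable borel"
    and G: "compact G" "G \<noteq> {}" "\<And>l. l \<in> {1..L} \<Longrightarrow> S l ` G \<subseteq> G"
    and r: "0 \<le> r" "r < 1"
    and contr: "\<And>l x y. l \<in> {1..L} \<Longrightarrow> dist (S l x) (S l y) \<le> r * dist x y"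
  shows "AE y in M. y \<in> G"
proof -
  interpret prob_space M using self_similar_measureD[OF M] by blast
  note [simp] = self_similar_measureD(2,3)[OF M]
  define E where "E t = {y. infdist y G \<le> t}" for t
  have borel_E: "E t \<in> sets borel" for t
    unfolding E_def by (intro borel_closed closed_Collect_le continuous_intros)
  obtain c \<rho> where c: "measure M (cball c \<rho>) = 1"
    using M by (auto simp: is_self_similar_measure_def)
  \<comment> \<open>Here \<open>\<rho>\<close> is the radius of the ball. By the triangle inequality
    the whole ball lies in \<open>E t\<close>, which starts the iteration.\<close>
  define t where "t = infdist c G + \<rho>"
  have "cball c \<rho> \<subseteq> E t"
  proof
    fix y
    assume "y \<in> cball c \<rho>"
    then show "y \<in> E t"
      using infdist_triangle[of y G c] by (simp add: E_def t_def dist_commute)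
  qed
  then have start: "prob (E t) = 1"
    using finite_measure_mono[of "cball c \<rho>" "E t"] prob_le_1[of "E t"] c borel_E by simp
  have step: "prob (E (r * s)) = 1" if s: "prob (E s) = 1" for s
  proof -
    have "prob (S l -` E (r * s)) = 1" if l: "l \<in> {1..L}" for l
    proof -
      have "E s \<subseteq> S l -` E (r * s)"
      proof
        fix y
        assume "y \<in> E s"
        then have "r * infdist y G \<le> r * s"
          using r by (simp add: E_def mult_left_mono)
        moreover have "infdist (S l y) G \<le> r * infdist y G"
          using G l contr by (intro infdist_contraction_le compact_imp_closed)
        ultimately show "y \<in> S l -` E (r * s)"
          by (simp add: E_def)
      qed
      moreover have "S l -` E (r * s) \<in> sets borel"
        using measurable_sets[OF S[OF l] borel_E] by simp
      ultimately show ?thesis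
        using finite_measure_mono[of "E s" "S l -` E (r * s)"] s prob_le_1[of "S l -` E (r * s)"]
        by simp
    qed
    then show ?thesis
      using self_similar_measureD(4)[OF M borel_E, of "r * s"] \<mu> by simp
  qed
  have "prob (E (r ^ q * t)) = 1" for q
    by (induction q) (use start step[of "r ^ _ * t"] in \<open>simp_all add: mult.assoc\<close>)
  then have "AE y in M. y \<in> E (r ^ q * t)" for q
    using prob_eq_1[of "E (r ^ q * t)"] borel_E by simp
  then have "AE y in M. \<forall>q. y \<in> E (r ^ q * t)"
    by (simp add: AE_all_countable)
  then show ?thesis
  proof (rule eventually_mono)
    fix y
    assume "\<forall>q. y \<in> E (r ^ q * t)"
    then have "infdist y G \<le> r ^ q * t" for q by (simp add: E_def)
    moreover have "(\<lambda>q. r ^ q * t) \<longlonglongrightarrow> 0"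
      using r by (intro tendsto_mult_left_zero LIMSEQ_power_zero) simp
    ultimately have "infdist y G \<le> 0"
      by (intro tendsto_lowerbound[of _ 0 sequentially]) auto
    then show "y \<in> G"
      using in_closed_iff_infdist_zero[of G y] G infdist_nonneg[of y G] compact_imp_closed by auto
  qed
qed

text \<open>The defining identity concerns measures of sets, that is, indicator functions. It
  extends through scaling, sums and monotone limits.\<close>

lemma nn_integral_self_similar_measure:
  fixes S :: "nat \<Rightarrow> real^'n \<Rightarrow> real^'n"
  assumes M: "is_self_similar_measure L S \<mu> M" and \<mu>: "\<And>l. l \<in> {1..L} \<Longrightarrow> 0 \<le> \<mu> l"
    and S: "\<And>l. l \<in> {1..L} \<Longrightarrow> S l \<in> borel_measurable borel"
    and g: "g \<in> borel_measurable M"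
  shows "(\<integral>\<^sup>+y. g y \<partial>M) = (\<Sum>l\<in>{1..L}. ennreal (\<mu> l) * (\<integral>\<^sup>+y. g (S l y) \<partial>M))"
proof -
  have comp: "(\<lambda>y. v (S l y)) \<in> borel_measurable M"
    if "v \<in> borel_measurable M" "l \<in> {1..L}" for v :: "_ \<Rightarrow> ennreal" and l
    using measurable_compose[of "S l" M M v borel] that S self_similar_measureD(2)[OF M]
    by (simp add: measurable_cong_sets[of M borel M borel])
  show ?thesis
    using g
  proof (induction rule: borel_measurable_induct)
    case (cong f g)
    then show ?case using self_similar_measureD(3)[OF M] by simp
  next
    case (set A)
    interpret prob_space M using self_similar_measureD[OF M] by blast
    have A: "A \<in> sets borel" "S l -` A \<in> sets M" if "l \<in> {1..L}" for l
      using set S[OF that, THEN measurable_sets, of A] self_similar_measureD(2)[OF M] by auto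
    have "(\<integral>\<^sup>+y. indicator A (S l y) \<partial>M) = ennreal (prob (S l -` A))" if "l \<in> {1..L}" for l
    proof -
      have "(\<integral>\<^sup>+y. indicator A (S l y) \<partial>M) = (\<integral>\<^sup>+y. indicator (S l -` A) y \<partial>M)"
        by (intro nn_integral_cong) (simp add: indicator_def)
      then show ?thesis using A[OF that] by (simp add: emeasure_eq_measure)
    qed
    then have "(\<Sum>l\<in>{1..L}. ennreal (\<mu> l) * (\<integral>\<^sup>+y. indicator A (S l y) \<partial>M))
        = (\<Sum>l\<in>{1..L}. ennreal (\<mu> l * prob (S l -` A)))"
      using \<mu> by (intro sum.cong) (simp_all add: ennreal_mult)
    also have "\<dots> = ennreal (prob A)"
      using \<mu> set self_similar_measureD(2,4)[OF M] by (subst sum_ennreal) auto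
    finally show ?case using set by (simp add: emeasure_eq_measure)
  next
    case (mult u c)
    then show ?case
      by (simp add: comp nn_integral_cmult sum_distrib_left mult.left_commute)
  next
    case (add u v)
    then show ?case
      by (simp add: comp nn_integral_add sum.distrib distrib_left)
  next
    case (seq U)
    have inc: "incseq (\<lambda>i y. U i (S l y))" for l
      using seq.hyps(3) by (auto simp: incseq_def le_fun_def)
    then have inc': "incseq (\<lambda>i. ennreal (\<mu> l) * (\<integral>\<^sup>+y. U i (S l y) \<partial>M))" for l
      by (auto simp: incseq_def le_fun_def intro!: mult_left_mono nn_integral_mono)
    have "(\<integral>\<^sup>+y. (SUP i. U i) y \<partial>M) = (SUP i. \<integral>\<^sup>+y. U i y \<partial>M)"
      using nn_integral_monotone_convergence_SUP[OF seq.hyps(3,1)] by (simp add: image_comp)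
    also have "\<dots> = (SUP i. \<Sum>l\<in>{1..L}. ennreal (\<mu> l) * (\<integral>\<^sup>+y. U i (S l y) \<partial>M))"
      using seq.IH by simp
    also have "\<dots> = (\<Sum>l\<in>{1..L}. SUP i. ennreal (\<mu> l) * (\<integral>\<^sup>+y. U i (S l y) \<partial>M))"
      using inc' by (intro ennreal_SUP_sum) auto
    also have "\<dots> = (\<Sum>l\<in>{1..L}. ennreal (\<mu> l) * (\<integral>\<^sup>+y. (SUP i. U i) (S l y) \<partial>M))"
    proof (rule sum.cong[OF refl])
      fix l
      assume l: "l \<in> {1..L}"
      have "(\<integral>\<^sup>+y. (SUP i. U i) (S l y) \<partial>M) = (SUP i. \<integral>\<^sup>+y. U i (S l y) \<partial>M)"
        using nn_integral_monotone_convergence_SUP[OF inc comp[OF seq.hyps(1) l]] by (simp add: image_comp)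
      then show "(SUP i. ennreal (\<mu> l) * (\<integral>\<^sup>+y. U i (S l y) \<partial>M))
          = ennreal (\<mu> l) * (\<integral>\<^sup>+y. (SUP i. U i) (S l y) \<partial>M)"
        by (simp add: SUP_mult_left_ennreal)
    qed
    finally show ?case .
  qed
qed

text \<open>Adding the bound \<open>B\<close> makes \<open>g\<close> nonnegative, so the identity
  for nonnegative integrals applies. The shift cancels because the measure has mass 1 and the
  weights sum to 1.\<close>

lemma integral_self_similar_measure:
  fixes S :: "nat \<Rightarrow> real^'n \<Rightarrow> real^'n" and g :: "real^'n \<Rightarrow> real"
  assumes M: "is_self_similar_measure L S \<mu> M"
    and \<mu>: "\<And>l. l \<in> {1..L} \<Longrightarrow> 0 \<le> \<mu> l" "(\<Sum>l\<in>{1..L}. \<mu> l) = 1"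
    and S: "\<And>l. l \<in> {1..L} \<Longrightarrow> S l \<in> borel_measurable borel"
    and g: "g \<in> borel_measurable borel" and B: "\<And>y. \<bar>g y\<bar> \<le> B"
  shows "(\<integral>y. g y \<partial>M) = (\<Sum>l\<in>{1..L}. \<mu> l * (\<integral>y. g (S l y) \<partial>M))"
proof -
  interpret prob_space M using self_similar_measureD[OF M] by blast
  note sets = self_similar_measureD(2)[OF M]
  have int: "integrable M u" if "u \<in> borel_measurable borel" "\<And>y. \<bar>u y\<bar> \<le> C" for u :: "_ \<Rightarrow> real" and C
    using that measurable_cong_sets[OF sets refl] by (intro integrable_const_bound[of _ C]) auto
  have g_int: "integrable M g" "\<And>l. l \<in> {1..L} \<Longrightarrow> integrable M (\<lambda>y. g (S l y))"
    using int[OF g B] int[OF measurable_compose[OF S g] B] by simp_all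
  have nonneg: "0 \<le> g y + B" for y
    using B[of y] by linarith
  have shift: "(\<integral>y. u y + B \<partial>M) = (\<integral>y. u y \<partial>M) + B" if "integrable M u" for u
    using that by (simp add: prob_space)
  have nn: "(\<integral>\<^sup>+y. ennreal (u y + B) \<partial>M) = ennreal ((\<integral>y. u y \<partial>M) + B)"
    if "integrable M u" "\<And>y. 0 \<le> u y + B" for u
    using nn_integral_eq_integral[of M "\<lambda>y. u y + B"] that by (simp only: shift) simp
  have pos: "0 \<le> (\<integral>y. u y \<partial>M) + B" if "integrable M u" "\<And>y. 0 \<le> u y + B" for u
    using integral_nonneg_AE[where M = M and f = "\<lambda>y. u y + B"] that shift[OF that(1)] by simp
  have pos': "0 \<le> \<mu> l * ((\<integral>y. g (S l y) \<partial>M) + B)" if "l \<in> {1..L}" for l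
    using \<mu>(1) pos[OF g_int(2)] nonneg that by (intro mult_nonneg_nonneg) simp_all
  have sum_pos: "0 \<le> (\<Sum>l\<in>{1..L}. \<mu> l * ((\<integral>y. g (S l y) \<partial>M) + B))"
    using pos' by (rule sum_nonneg)
  have "(\<lambda>y. ennreal (g y + B)) \<in> borel_measurable M"
    using g_int by measurable
  from nn_integral_self_similar_measure[OF M \<mu>(1) S this]
  have "ennreal ((\<integral>y. g y \<partial>M) + B)
      = (\<Sum>l\<in>{1..L}. ennreal (\<mu> l) * ennreal ((\<integral>y. g (S l y) \<partial>M) + B))"
    by (simp add: nn g_int nonneg)
  also have "\<dots> = (\<Sum>l\<in>{1..L}. ennreal (\<mu> l * ((\<integral>y. g (S l y) \<partial>M) + B)))"
    using \<mu>(1) pos[OF g_int(2)] nonneg by (intro sum.cong) (simp_all add: ennreal_mult)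
  also have "\<dots> = ennreal (\<Sum>l\<in>{1..L}. \<mu> l * ((\<integral>y. g (S l y) \<partial>M) + B))"
    using pos' by (intro sum_ennreal)
  finally have "(\<integral>y. g y \<partial>M) + B = (\<Sum>l\<in>{1..L}. \<mu> l * ((\<integral>y. g (S l y) \<partial>M) + B))"
    using ennreal_inj[OF pos[OF g_int(1) nonneg] sum_pos] by blast
  also have "\<dots> = (\<Sum>l\<in>{1..L}. \<mu> l * (\<integral>y. g (S l y) \<partial>M)) + B"
    using \<mu>(2) by (simp add: distrib_left sum.distrib flip: sum_distrib_right)
  finally show ?thesis by simp
qed

lemma set_integrable_compact:
  fixes g :: "real^'n \<Rightarrow> real"
  assumes "finite_measure M" "sets M = sets borel" "compact G" "continuous_on G g"
  shows "set_integrable M G g"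
proof -
  interpret finite_measure M by fact
  obtain B where B: "\<And>y. y \<in> G \<Longrightarrow> \<bar>g y\<bar> \<le> B"
    using compact_imp_bounded[OF compact_continuous_image[OF assms(4,3)]]
    by (auto simp: bounded_iff)
  have "(\<lambda>y. indicator G y *\<^sub>R g y) \<in> borel_measurable borel"
    using assms by (intro borel_measurable_continuous_on_indicator) (simp_all add: compact_imp_closed)
  \<comment> \<open>\<open>B\<close> bounds the function only on \<open>G\<close> and could be
    negative if \<open>G\<close> is empty; the extension is 0 elsewhere, hence
    \<open>max 0 B\<close>.\<close>
  then show ?thesis
    unfolding set_integrable_def using B
    by (intro integrable_const_bound[of _ "max 0 B"] AE_I2)
       (auto simp: indicator_def measurable_cong_sets[OF assms(2) refl] le_max_iff_disj)
qed

text \<open>Since \<open>g\<close> is continuous only on \<open>G\<close>, it is extended by 0 to a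
  bounded Borel function \<open>u\<close>. Composed with \<open>S l\<close>, this may differ from
  the integrand over \<open>G\<close>, as points outside \<open>G\<close> can be mapped into
  \<open>G\<close>, but only on a null set.\<close>

lemma set_integral_self_similar_measure:
  fixes S :: "nat \<Rightarrow> real^'n \<Rightarrow> real^'n" and g :: "real^'n \<Rightarrow> real"
  assumes M: "is_self_similar_measure L S \<mu> M"
    and \<mu>: "\<And>l. l \<in> {1..L} \<Longrightarrow> 0 \<le> \<mu> l" "(\<Sum>l\<in>{1..L}. \<mu> l) = 1"
    and S: "\<And>l. l \<in> {1..L} \<Longrightarrow> S l \<in> borel_measurable borel"
    and G: "compact G" "\<And>l. l \<in> {1..L} \<Longrightarrow> S l ` G \<subseteq> G" "AE y in M. y \<in> G"
    and g: "continuous_on G g"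
  shows "(LINT y:G|M. g y) = (\<Sum>l\<in>{1..L}. \<mu> l * (LINT y:G|M. g (S l y)))"
proof -
  define u where "u y = indicator G y *\<^sub>R g y" for y
  note sets = self_similar_measureD(2)[OF M]
  have u: "u \<in> borel_measurable borel"
    unfolding u_def using G g
    by (intro borel_measurable_continuous_on_indicator) (simp_all add: compact_imp_closed)
  obtain B where B: "\<And>y. y \<in> G \<Longrightarrow> \<bar>g y\<bar> \<le> B"
    using compact_imp_bounded[OF compact_continuous_image[OF g G(1)]]
    by (auto simp: bounded_iff)
  have uB: "\<bar>u y\<bar> \<le> max 0 B" for y
    using B[of y] by (auto simp: u_def indicator_def)
  have "(LINT y:G|M. g (S l y)) = (\<integral>y. u (S l y) \<partial>M)" if l: "l \<in> {1..L}" for l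
  proof -
    have "(LINT y:G|M. g (S l y)) = (\<integral>y. indicator G y *\<^sub>R u (S l y) \<partial>M)"
      unfolding set_lebesgue_integral_def using G(2)[OF l]
      by (intro Bochner_Integration.integral_cong) (auto simp: u_def indicator_def)
    also have "\<dots> = (\<integral>y. u (S l y) \<partial>M)"
    proof (rule integral_cong_AE)
      have meas: "(\<lambda>y. u (S l y)) \<in> borel_measurable M"
        using measurable_compose[OF S[OF l] u] measurable_cong_sets[OF sets refl] by blast
      then show "(\<lambda>y. u (S l y)) \<in> borel_measurable M" .
      have "G \<in> sets M"
        using G(1) sets by (simp add: compact_imp_closed)
      then show "(\<lambda>y. indicator G y *\<^sub>R u (S l y)) \<in> borel_measurable M"
        using meas by measurable
      show "AE y in M. indicator G y *\<^sub>R u (S l y) = u (S l y)"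
        using G(3) by (rule eventually_mono) simp
    qed
    finally show ?thesis .
  qed
  then show ?thesis
    using integral_self_similar_measure[OF M \<mu> S u uB]
    by (simp add: set_lebesgue_integral_def u_def)
qed

section \<open>Words\<close>

lemma word_map_Nil [simp]: "word_map S [] = id"
  by (simp add: word_map_def)

lemma word_map_Cons [simp]: "word_map S (l # m) = S l \<circ> word_map S m"
  by (simp add: word_map_def)

lemma word_map_snoc: "word_map S (m @ [l]) = word_map S m \<circ> S l"
  by (induction m) (simp_all add: comp_assoc)

lemma word_prod_Nil [simp]: "word_prod \<rho> [] = 1"
  by (simp add: word_prod_def)

lemma word_prod_Cons [simp]: "word_prod \<rho> (l # m) = \<rho> l * word_prod \<rho> m"
  by (simp add: word_prod_def)

lemma word_prod_snoc: "word_prod \<rho> (m @ [l]) = word_prod \<rho> m * \<rho> l"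
  by (simp add: word_prod_def)

lemma word_prod_nonneg: "(\<And>l. l \<in> set m \<Longrightarrow> 0 \<le> \<rho> l) \<Longrightarrow> 0 \<le> word_prod \<rho> m"
  by (induction m) simp_all

lemma word_prod_le_power:
  "(\<And>l. l \<in> set m \<Longrightarrow> 0 \<le> \<rho> l \<and> \<rho> l \<le> r) \<Longrightarrow> word_prod \<rho> m \<le> r ^ length m"
proof (induction m)
  case (Cons l m)
  have "0 \<le> \<rho> l" "\<rho> l \<le> r" using Cons.prems[of l] by simp_all
  moreover have "word_prod \<rho> m \<le> r ^ length m" "0 \<le> word_prod \<rho> m"
    using Cons by (simp_all add: word_prod_nonneg)
  ultimately show ?case by (simp add: mult_mono)
qed simp

lemma word_map_image_subset:
  "set m \<subseteq> I \<Longrightarrow> (\<And>l. l \<in> I \<Longrightarrow> S l ` G \<subseteq> G) \<Longrightarrow> word_map S m ` G \<subseteq> G"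
  by (induction m) (auto simp: image_subset_iff)

lemma dist_word_map_le:
  assumes "\<And>l x y. dist (S l x) (S l y) \<le> \<rho> l * dist x y" and "\<And>l. 0 \<le> \<rho> l"
  shows "dist (word_map S m x) (word_map S m y) \<le> word_prod \<rho> m * dist x y"
proof (induction m)
  case (Cons l m)
  have "dist (S l (word_map S m x)) (S l (word_map S m y)) \<le> \<rho> l * (word_prod \<rho> m * dist x y)"
    by (rule order_trans[OF assms(1) mult_left_mono[OF Cons.IH assms(2)]])
  then show ?case by (simp add: mult.assoc)
qed simp

lemma word_map_affine:
  "\<exists>B c. word_map (affine_map A b) m = (\<lambda>x. B *v x + c)"
proof (induction m)
  case Nil
  have "word_map (affine_map A b) [] = (\<lambda>x. mat 1 *v x + 0)" by auto
  then show ?case by blast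
next
  case (Cons l m)
  then obtain B c where "word_map (affine_map A b) m = (\<lambda>x. B *v x + c)" by blast
  then have "word_map (affine_map A b) (l # m) = (\<lambda>x. (A l ** B) *v x + (A l *v c + b l))"
    by (simp add: affine_map_def fun_eq_iff matrix_vector_right_distrib matrix_vector_mul_assoc)
  then show ?case by blast
qed

lemma spectral_norm_nonneg: "0 \<le> spectral_norm B"
  unfolding spectral_norm_def by (rule onorm_pos_le) (rule matrix_vector_mul_bounded_linear)

lemma dist_affine_map_le:
  "dist (affine_map A b l x) (affine_map A b l y) \<le> spectral_norm (A l) * dist x y"
proof -
  have "dist (affine_map A b l x) (affine_map A b l y) = norm (A l *v (x - y))"
    by (simp add: affine_map_def dist_norm matrix_vector_mult_diff_distrib)
  also have "\<dots> \<le> spectral_norm (A l) * norm (x - y)"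
    unfolding spectral_norm_def by (rule onorm) (rule matrix_vector_mul_bounded_linear)
  finally show ?thesis by (simp add: dist_norm)
qed

section \<open>Refinement levels, their stationary value and their cells\<close>

lemma word_level_SucE:
  assumes "m \<in> word_level L \<rho> d h (Suc q)"
  obtains "m \<in> word_level L \<rho> d h q" "word_prod \<rho> m * d \<le> h"
  | m' l where "m = m' @ [l]" "m' \<in> word_level L \<rho> d h q" "h < word_prod \<rho> m' * d" "l \<in> {1..L}"
  using assms by (auto simp: coarse_words_def not_less)

text \<open>A word shorter than \<open>q\<close> was left unsplit at an earlier stage, which happens
  only to fine words. Hence only words of full length \<open>q\<close> can still be coarse at level
  \<open>q\<close>.\<close>

lemma word_level_invariant:
  assumes "m \<in> word_level L \<rho> d h q"
  shows "length m \<le> q" "set m \<subseteq> {1..L}" "length m < q \<Longrightarrow> word_prod \<rho> m * d \<le> h"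
proof -
  have "length m \<le> q \<and> set m \<subseteq> {1..L} \<and> (length m < q \<longrightarrow> word_prod \<rho> m * d \<le> h)"
    using assms
  proof (induction q arbitrary: m)
    case (Suc q)
    from Suc.prems show ?case
    proof (cases rule: word_level_SucE)
      case 1
      then show ?thesis using Suc.IH[OF 1(1)] by simp
    next
      case (2 m' l)
      then show ?thesis using Suc.IH[OF 2(2)] by auto
    qed
  qed simp
  then show "length m \<le> q" "set m \<subseteq> {1..L}" "length m < q \<Longrightarrow> word_prod \<rho> m * d \<le> h"
    by blast+
qed

lemma finite_word_level: "finite (word_level L \<rho> d h q)"
  by (rule finite_subset[OF _ finite_lists_length_le[of "{1..L}" q]])
     (auto dest: word_level_invariant(1) subsetD[OF word_level_invariant(2)])

text \<open>A coarse word at level \<open>q\<close> has length \<open>q\<close>, so its product is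
  at most \<open>r ^ q\<close>, and \<open>r ^ q * d\<close> eventually drops below
  \<open>h\<close>.\<close>

lemma eventually_no_coarse_words:
  assumes \<rho>: "\<And>l. l \<in> {1..L} \<Longrightarrow> 0 \<le> \<rho> l \<and> \<rho> l \<le> r" and r: "r < 1"
    and d: "0 \<le> d" and h: "0 < h"
  shows "\<forall>\<^sub>F q in sequentially. coarse_words \<rho> d h (word_level L \<rho> d h q) = {}"
proof (cases "1 \<le> L")
  case True
  then have "0 \<le> r" using \<rho>[of 1] by auto
  then have "(\<lambda>q. r ^ q * d) \<longlonglongrightarrow> 0"
    using r by (intro tendsto_mult_left_zero LIMSEQ_power_zero) simp
  then have "\<forall>\<^sub>F q in sequentially. r ^ q * d < h"
    using h by (rule order_tendstoD)
  then show ?thesis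
  proof (rule eventually_mono)
    fix q
    assume q: "r ^ q * d < h"
    have "word_prod \<rho> m * d \<le> h" if m: "m \<in> word_level L \<rho> d h q" for m
    proof (cases "length m < q")
      case False
      then have "length m = q" using word_level_invariant(1)[OF m] by simp
      then have "word_prod \<rho> m \<le> r ^ q"
        using word_prod_le_power[of m \<rho> r] \<rho> word_level_invariant(2)[OF m] by blast
      then have "word_prod \<rho> m * d \<le> r ^ q * d"
        using d by (rule mult_right_mono)
      then show ?thesis using q by simp
    qed (use word_level_invariant(3)[OF m] in simp)
    then show "coarse_words \<rho> d h (word_level L \<rho> d h q) = {}"
      by (auto simp: coarse_words_def not_less)
  qed
next
  case False
  have "word_level L \<rho> d h (Suc q) \<subseteq> {m \<in> {[]}. word_prod \<rho> m * d \<le> h}" for q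
    using False by (induction q) (auto simp: coarse_words_def)
  then have "\<forall>\<^sub>F q in sequentially. coarse_words \<rho> d h (word_level L \<rho> d h (Suc q)) = {}"
    by (intro always_eventually allI) (fastforce simp: coarse_words_def)
  then show ?thesis
    by (rule eventually_sequentially_Suc[THEN iffD1])
qed

text \<open>Without coarse words a refinement step changes nothing. The definite description is then
  legitimate: two eventual values are both attained at some common level, hence equal.\<close>

lemma stationary_words_eq_word_level:
  assumes "\<And>l. l \<in> {1..L} \<Longrightarrow> 0 \<le> \<rho> l \<and> \<rho> l \<le> r" and "r < 1"
    and "0 \<le> d" and "0 < h"
  obtains q where "stationary_words L \<rho> d h = word_level L \<rho> d h q"
    and "\<And>m. m \<in> word_level L \<rho> d h q \<Longrightarrow> word_prod \<rho> m * d \<le> h"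
proof -
  have "\<forall>\<^sub>F q in sequentially. coarse_words \<rho> d h (word_level L \<rho> d h q) = {}"
    using assms by (rule eventually_no_coarse_words)
  then obtain q where q: "\<And>j. j \<ge> q \<Longrightarrow> coarse_words \<rho> d h (word_level L \<rho> d h j) = {}"
    by (auto simp: eventually_sequentially)
  have "word_level L \<rho> d h j = word_level L \<rho> d h q" if "j \<ge> q" for j
    using that
  proof (induction rule: dec_induct)
    case (step j)
    have "word_level L \<rho> d h (Suc j) = word_level L \<rho> d h j"
      unfolding word_level.simps q[OF step.hyps(1)] by simp
    then show ?case using step.IH by (rule trans)
  qed (rule refl)
  then have ev: "\<forall>\<^sub>F j in sequentially. word_level L \<rho> d h j = word_level L \<rho> d h q"
    by (rule eventually_sequentiallyI)
  have "stationary_words L \<rho> d h = word_level L \<rho> d h q"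
    unfolding stationary_words_def
  proof (rule the_equality)
    show "\<forall>\<^sub>F j in sequentially. word_level L \<rho> d h j = word_level L \<rho> d h q"
      by (rule ev)
  next
    fix W
    assume "\<forall>\<^sub>F j in sequentially. word_level L \<rho> d h j = W"
    from eventually_happens[OF eventually_conj[OF ev this]] show "W = word_level L \<rho> d h q"
      by auto
  qed
  then show ?thesis
  proof (rule that)
    show "word_prod \<rho> m * d \<le> h" if "m \<in> word_level L \<rho> d h q" for m
      using q[of q] that by (force simp: coarse_words_def)
  qed
qed

text \<open>Splitting a word into its children preserves the total of an additive quantity. It
  serves for the weights, whose total is thus 1, and for the weighted integrals over the
  cells.\<close>

lemma sum_word_level:
  fixes I :: "nat list \<Rightarrow> 'a::comm_monoid_add"
  assumes split: "\<And>m. set m \<subseteq> {1..L} \<Longrightarrow> I m = (\<Sum>l\<in>{1..L}. I (m @ [l]))"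
  shows "(\<Sum>m\<in>word_level L \<rho> d h q. I m) = I []"
proof (induction q)
  case (Suc q)
  define W where "W = word_level L \<rho> d h q"
  define N where "N = coarse_words \<rho> d h W"
  have W: "finite W" "N \<subseteq> W"
    by (auto simp: W_def N_def coarse_words_def finite_word_level)
  have len: "length m = q" if "m \<in> N" for m
    using that word_level_invariant[of m L \<rho> d h q]
    by (force simp: N_def W_def coarse_words_def)
  have ext: "{m @ [l] | m l. m \<in> N \<and> l \<in> {1..L}} = (\<lambda>(m, l). m @ [l]) ` (N \<times> {1..L})"
    by auto
  \<comment> \<open>Children have length \<open>q + 1\<close>, retained words at most
    \<open>q\<close>, so nothing is counted twice.\<close>
  have disj: "(W - N) \<inter> (\<lambda>(m, l). m @ [l]) ` (N \<times> {1..L}) = {}"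
    using len word_level_invariant(1) by (fastforce simp: W_def)
  have "(\<Sum>m\<in>word_level L \<rho> d h (Suc q). I m)
      = (\<Sum>m\<in>W - N. I m) + (\<Sum>m\<in>(\<lambda>(m, l). m @ [l]) ` (N \<times> {1..L}). I m)"
    unfolding word_level.simps W_def[symmetric] N_def[symmetric] ext
    using W by (intro sum.union_disjoint disj) (auto intro: finite_subset)
  also have "(\<Sum>m\<in>(\<lambda>(m, l). m @ [l]) ` (N \<times> {1..L}). I m) = (\<Sum>m\<in>N. \<Sum>l\<in>{1..L}. I (m @ [l]))"
    by (subst sum.reindex) (auto simp: inj_on_def sum.cartesian_product case_prod_unfold)
  also have "\<dots> = (\<Sum>m\<in>N. I m)"
    using split word_level_invariant(2) W by (intro sum.cong) (auto simp: W_def subset_iff)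
  also have "(\<Sum>m\<in>W - N. I m) + \<dots> = (\<Sum>m\<in>W. I m)"
    by (rule sum.subset_diff[OF W(2,1), symmetric])
  finally show ?case using Suc.IH by (simp add: W_def)
qed simp

text \<open>A point of a split cell lies in one of the child cells, so refinement preserves the
  covering. This is what places \<Gamma> inside \<open>F\<close>.\<close>

lemma subset_Union_word_level:
  assumes "G \<subseteq> (\<Union>l\<in>{1..L}. S l ` G)"
  shows "G \<subseteq> (\<Union>m\<in>word_level L \<rho> d h q. word_map S m ` G)"
proof (induction q)
  case (Suc q)
  show ?case
  proof
    fix y
    assume "y \<in> G"
    then obtain m z where m: "m \<in> word_level L \<rho> d h q" and z: "z \<in> G" "y = word_map S m z"
      using Suc.IH by blast
    show "y \<in> (\<Union>m\<in>word_level L \<rho> d h (Suc q). word_map S m ` G)"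
    proof (cases "m \<in> coarse_words \<rho> d h (word_level L \<rho> d h q)")
      case True
      obtain l u where l: "l \<in> {1..L}" "u \<in> G" "z = S l u"
        using z assms by blast
      have "m @ [l] \<in> word_level L \<rho> d h (Suc q)"
        using True l(1) by auto
      moreover have "y = word_map S (m @ [l]) u"
        using z l by (simp add: word_map_snoc)
      ultimately show ?thesis using l(2) by blast
    next
      case False
      then have "m \<in> word_level L \<rho> d h (Suc q)" using m by simp
      then show ?thesis using z by blast
    qed
  qed
qed simp

text \<open>
  All but finitely many of the sets \<open>word_map S m ` K\<close> lie in any given neighbourhood of \<open>G\<close>;
  this is what makes a continuous function bounded on a union which need not be closed.
\<close>

lemma word_images_subset_compact:
  fixes S :: "nat \<Rightarrow> 'a::heine_borel \<Rightarrow> 'a"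
  assumes contr: "\<And>l x y. dist (S l x) (S l y) \<le> \<rho> l * dist x y" and \<rho>0: "\<And>l. 0 \<le> \<rho> l"
    and \<rho>: "\<And>l. l \<in> {1..L} \<Longrightarrow> \<rho> l \<le> r" and r: "0 \<le> r" "r < 1"
    and cont: "\<And>m. continuous_on K (word_map S m)"
    and G: "compact G" "G \<noteq> {}" "\<And>l. l \<in> {1..L} \<Longrightarrow> S l ` G \<subseteq> G" "G \<subseteq> K"
    and K: "compact K" and V: "\<And>m. m \<in> V \<Longrightarrow> set m \<subseteq> {1..L}"
    and U: "open U" "G \<subseteq> U" "(\<Union>m\<in>V. word_map S m ` K) \<subseteq> U"
  obtains C where "compact C" "C \<subseteq> U" "(\<Union>m\<in>V. word_map S m ` K) \<subseteq> C"
proof -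
  obtain e where e: "0 < e" "(\<Union>x\<in>G. cball x e) \<subseteq> U"
    using compact_subset_open_imp_cball_epsilon_subset[OF G(1) U(1,2)] by blast
  \<comment> \<open>A closed neighbourhood of \<open>G\<close> within \<open>U\<close>; it is
    compact because \<open>G\<close> is.\<close>
  define Z where "Z = {x. infdist x G \<le> e}"
  have "compact Z"
    unfolding Z_def using G e by (intro compact_infdist_le)
  have "Z \<subseteq> U"
  proof
    fix x
    assume "x \<in> Z"
    obtain y where "y \<in> G" "infdist x G = dist x y"
      using infdist_attains_inf[of G x] G compact_imp_closed by blast
    then have "x \<in> cball y e"
      using \<open>x \<in> Z\<close> by (simp add: Z_def dist_commute)
    then show "x \<in> U"
      using e(2) \<open>y \<in> G\<close> by blast
  qed
  \<comment> \<open>The words whose cells may be too large to fit into \<open>Z\<close>. The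
    products decay with the length, so there are only finitely many.\<close>
  define V' where "V' = {m \<in> V. e < word_prod \<rho> m * diameter K}"
  have "(\<lambda>q. r ^ q * diameter K) \<longlonglongrightarrow> 0"
    using r by (intro tendsto_mult_left_zero LIMSEQ_power_zero) simp
  then have "\<forall>\<^sub>F q in sequentially. r ^ q * diameter K < e"
    using e(1) by (rule order_tendstoD)
  then obtain q where q: "\<And>j. j \<ge> q \<Longrightarrow> r ^ j * diameter K < e"
    by (auto simp: eventually_sequentially)
  have "length m \<le> q" if "m \<in> V'" for m
  proof (rule ccontr)
    assume "\<not> length m \<le> q"
    then have "r ^ length m * diameter K < e"
      using q[of "length m"] by simp
    moreover have "word_prod \<rho> m \<le> r ^ length m"
    proof (rule word_prod_le_power)
      fix l
      assume "l \<in> set m"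
      moreover have "set m \<subseteq> {1..L}" using that V[of m] by (simp add: V'_def)
      ultimately have "l \<in> {1..L}" by (rule subsetD[rotated])
      then show "0 \<le> \<rho> l \<and> \<rho> l \<le> r" using \<rho>[of l] \<rho>0[of l] by simp
    qed
    then have "word_prod \<rho> m * diameter K \<le> r ^ length m * diameter K"
      using diameter_ge_0[OF compact_imp_bounded[OF K]] by (rule mult_right_mono)
    moreover have "e < word_prod \<rho> m * diameter K" using that by (simp add: V'_def)
    ultimately show False by linarith
  qed
  then have "V' \<subseteq> {m. set m \<subseteq> {1..L} \<and> length m \<le> q}"
    using V unfolding V'_def by blast
  then have "finite V'"
    by (rule finite_subset) (rule finite_lists_length_le, rule finite_atLeastAtMost)
  then have "compact (Z \<union> (\<Union>m\<in>V'. word_map S m ` K))"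
    by (intro compact_Un[OF \<open>compact Z\<close>] compact_UN compact_continuous_image[OF cont K])
  moreover have "Z \<union> (\<Union>m\<in>V'. word_map S m ` K) \<subseteq> U"
    using \<open>Z \<subseteq> U\<close> U(3) unfolding V'_def by blast
  \<comment> \<open>Every cell contains a point of \<open>G\<close>, the image of one, so a cell of
    diameter at most \<open>e\<close> stays within \<open>Z\<close>.\<close>
  moreover have "word_map S m y \<in> Z" if m: "m \<in> V" "m \<notin> V'" and y: "y \<in> K" for m y
  proof -
    obtain g where g: "g \<in> G" using G(2) by blast
    have "dist (word_map S m y) (word_map S m g) \<le> word_prod \<rho> m * dist y g"
      by (rule dist_word_map_le[where S = S, OF contr \<rho>0])
    also have "\<dots> \<le> word_prod \<rho> m * diameter K"
      using diameter_bounded_bound[OF compact_imp_bounded[OF K] y subsetD[OF G(4) g]] \<rho>0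
      by (intro mult_left_mono word_prod_nonneg)
    also have "\<dots> \<le> e" using m by (simp add: V'_def)
    finally have "dist (word_map S m y) (word_map S m g) \<le> e" .
    moreover have "word_map S m g \<in> G"
      using word_map_image_subset[where S = S, OF V[OF m(1)] G(3)] g by blast
    ultimately show ?thesis
      using infdist_le2 by (simp add: Z_def)
  qed
  then have "(\<Union>m\<in>V. word_map S m ` K) \<subseteq> Z \<union> (\<Union>m\<in>V'. word_map S m ` K)"
    by blast
  ultimately show ?thesis by (rule that)
qed

section \<open>Error estimate\<close>

lemma abs_set_integral_le:
  fixes u :: "real^'n \<Rightarrow> real"
  assumes "prob_space M" and u: "set_integrable M G u"
    and R: "0 \<le> R" "\<And>y. y \<in> G \<Longrightarrow> \<bar>u y\<bar> \<le> R"
  shows "\<bar>LINT y:G|M. u y\<bar> \<le> R"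
proof -
  interpret prob_space M by fact
  have int: "integrable M (\<lambda>y. indicator G y *\<^sub>R u y)"
    using u by (simp add: set_integrable_def)
  have "\<bar>LINT y:G|M. u y\<bar> \<le> (\<integral>y. \<bar>indicator G y *\<^sub>R u y\<bar> \<partial>M)"
    unfolding set_lebesgue_integral_def by (rule integral_abs_bound)
  also have "\<dots> \<le> (\<integral>y. R \<partial>M)"
    using int R by (intro integral_mono integrable_abs) (auto simp: indicator_def)
  also have "\<dots> = R" by (simp add: prob_space)
  finally show ?thesis .
qed

text \<open>By exactness on \<open>p\<close> the error for \<open>g\<close> is the error for
  \<open>g - p\<close>. The cubature of \<open>g - p\<close> costs |w|_1 times \<open>R\<close>, its
  integral against a probability measure costs \<open>R\<close>.\<close>

lemma cubature_error_le:
  fixes g :: "real^'n \<Rightarrow> real"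
  assumes "prob_space M" "sets M = sets borel" "compact G" "continuous_on G g"
    and GK: "G \<subseteq> K" and x: "x ` {1..N} \<subseteq> K"
    and exact: "\<And>p. p \<in> poly_space k \<Longrightarrow> cubature N w x p = (LINT y:G|M. p y)"
    and p: "p \<in> poly_space k" and R: "\<And>y. y \<in> K \<Longrightarrow> \<bar>g y - p y\<bar> \<le> R" "0 \<le> R"
  shows "\<bar>cubature N w x g - (LINT y:G|M. g y)\<bar> \<le> ((\<Sum>i\<in>{1..N}. \<bar>w i\<bar>) + 1) * R"
proof -
  interpret prob_space M by fact
  have int: "set_integrable M G g" "set_integrable M G p"
    using assms p continuous_on_poly_space
    by (auto intro!: set_integrable_compact finite_measure_axioms)
  have "\<bar>LINT y:G|M. g y - p y\<bar> \<le> R"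
    using R GK by (intro abs_set_integral_le set_integral_diff int \<open>prob_space M\<close>) auto
  then have 1: "\<bar>(LINT y:G|M. g y) - (LINT y:G|M. p y)\<bar> \<le> R"
    by (simp add: set_integral_diff int)
  have "cubature N w x g - cubature N w x p = (\<Sum>i\<in>{1..N}. w i * (g (x i) - p (x i)))"
    by (simp add: cubature_def sum_subtractf right_diff_distrib)
  also have "\<bar>\<dots>\<bar> \<le> (\<Sum>i\<in>{1..N}. \<bar>w i\<bar> * R)"
  proof (rule order_trans[OF sum_abs sum_mono])
    fix i
    assume "i \<in> {1..N}"
    then have "x i \<in> K" using x by blast
    then show "\<bar>w i * (g (x i) - p (x i))\<bar> \<le> \<bar>w i\<bar> * R"
      unfolding abs_mult by (intro mult_left_mono R(1)) simp_all
  qed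
  finally have 2: "\<bar>cubature N w x g - cubature N w x p\<bar> \<le> (\<Sum>i\<in>{1..N}. \<bar>w i\<bar>) * R"
    by (simp add: sum_distrib_right)
  show ?thesis
    using 1 2 exact[OF p] by (simp add: distrib_right abs_le_iff)
qed

theorem theorem5p4:
  fixes L M k :: nat
    and A :: "nat \<Rightarrow> real^'n^'n" and b :: "nat \<Rightarrow> real^'n"
    and S :: "nat \<Rightarrow> real^'n \<Rightarrow> real^'n" and \<rho> \<mu> w :: "nat \<Rightarrow> real"
    and \<Gamma> K F :: "(real^'n) set" and \<M> :: "(real^'n) measure"
    and x :: "nat \<Rightarrow> real^'n" and P :: "(real^'n \<Rightarrow> real) set"
    and H h C :: real and f :: "real^'n \<Rightarrow> real"
    and W :: "real \<Rightarrow> nat list set"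
  defines "S \<equiv> affine_map A b"
    and "\<rho> \<equiv> \<lambda>l. spectral_norm (A l)"
    and "W \<equiv> stationary_words L \<rho> (diameter \<Gamma>)"
    and "F \<equiv> (\<Union>\<delta>\<in>{0<..H}. refined_set S (W \<delta>) K)"
    and "C \<equiv> (diameter K / diameter \<Gamma>) ^ (k + 1) * ((\<Sum>i\<in>{1..M}. \<bar>w i\<bar>) + 1) *
              (\<Sum>\<beta>\<in>multi_indices (k + 1). 1 / (\<Prod>i\<in>(UNIV::'n set). fact (\<beta> i)))"
  assumes "2 \<le> L" and "\<And>l. l \<in> {1..L} \<Longrightarrow> \<rho> l < 1"
    and "is_attractor L S \<Gamma>" and "0 < diameter \<Gamma>"
    and "\<And>l. l \<in> {1..L} \<Longrightarrow> 0 < \<mu> l \<and> \<mu> l < 1" and "(\<Sum>l\<in>{1..L}. \<mu> l) = 1"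
    and "is_self_similar_measure L S \<mu> \<M>"
    and "unisolvent M x P" and "poly_space k \<subseteq> P"
    and "convex K" and "compact K" and "\<Gamma> \<subseteq> K" and "x ` {1..M} \<subseteq> K"
    and "0 < H"
    and "\<And>p. p \<in> poly_space k \<Longrightarrow> cubature M w x p = (LINT y:\<Gamma>|\<M>. p y)"
    and "C_k_near (k + 1) f F"
    and "0 < h" and "h \<le> H"
  shows "\<bar>refined_cubature S \<mu> (W h) M w x f - (LINT y:\<Gamma>|\<M>. f y)\<bar>
         \<le> C * h ^ (k + 1) * deriv_norm (k + 1) F f"
proof -
  note \<rho>_less = assms(7) and exact = assms(20)
  have \<Gamma>: "compact \<Gamma>" "\<Gamma> \<noteq> {}" "\<Gamma> = (\<Union>l\<in>{1..L}. S l ` \<Gamma>)"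
    using \<open>is_attractor L S \<Gamma>\<close> by (simp_all add: is_attractor_def)
  then have S\<Gamma>: "S l ` \<Gamma> \<subseteq> \<Gamma>" if "l \<in> {1..L}" for l
    using that by blast
  have \<mu>0: "0 \<le> \<mu> l" if "l \<in> {1..L}" for l
    using assms(10)[OF that] by simp
  have contr: "dist (S l u) (S l v) \<le> \<rho> l * dist u v" for l u v
    unfolding S_def \<rho>_def by (rule dist_affine_map_le)
  have \<rho>0: "0 \<le> \<rho> l" for l
    unfolding \<rho>_def by (rule spectral_norm_nonneg)
  \<comment> \<open>A uniform contraction ratio. The alphabet is nonempty, so the maximum is
    attained and is below 1.\<close>
  define r where "r = Max (\<rho> ` {1..L})"
  have "1 \<in> {1..L}" using \<open>2 \<le> L\<close> by simp
  then have "r \<in> \<rho> ` {1..L}"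
    unfolding r_def by (intro Max_in) auto
  then have r: "0 \<le> r" "r < 1"
    using \<rho>0 \<rho>_less by auto
  have \<rho>_le: "\<rho> l \<le> r" if "l \<in> {1..L}" for l
    unfolding r_def using that by (intro Max_ge) auto
  have affine: "\<exists>B c. word_map S m = (\<lambda>y. B *v y + c)" for m
    unfolding S_def by (rule word_map_affine)
  have cont: "continuous_on Y (word_map S m)" for Y m
  proof -
    obtain B c where "word_map S m = (\<lambda>y. B *v y + c)" using affine by blast
    then show ?thesis
      by (simp add: continuous_on_add linear_continuous_on matrix_vector_mul_bounded_linear)
  qed
  have meas: "S l \<in> borel_measurable borel" for l
    using cont[of UNIV "[l]"] by (intro borel_measurable_continuous_onI) simp
  interpret prob_space \<M>
    using self_similar_measureD(1)[OF \<open>is_self_similar_measure L S \<mu> \<M>\<close>] .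
  note sets = self_similar_measureD(2)[OF \<open>is_self_similar_measure L S \<mu> \<M>\<close>]
  have ae: "AE y in \<M>. y \<in> \<Gamma>"
  proof (rule AE_self_similar_measure_attractor[OF \<open>is_self_similar_measure L S \<mu> \<M>\<close>
        \<open>(\<Sum>l\<in>{1..L}. \<mu> l) = 1\<close> meas \<Gamma>(1,2) S\<Gamma> r])
    show "dist (S l u) (S l v) \<le> r * dist u v" if "l \<in> {1..L}" for l u v
      by (rule order_trans[OF contr mult_right_mono[OF \<rho>_le[OF that]]]) simp
  qed

  have d: "0 \<le> diameter \<Gamma>" using \<open>0 < diameter \<Gamma>\<close> by simp
  have level: "\<exists>q. W \<delta> = word_level L \<rho> (diameter \<Gamma>) \<delta> q \<and>
      (\<forall>m\<in>W \<delta>. word_prod \<rho> m * diameter \<Gamma> \<le> \<delta>)" if "0 < \<delta>" for \<delta>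
    using stationary_words_eq_word_level[of L \<rho> r "diameter \<Gamma>" \<delta>] \<rho>0 \<rho>_le r(2) d that
    unfolding W_def by metis
  have W_letters: "set m \<subseteq> {1..L}" if "m \<in> W \<delta>" "0 < \<delta>" for m \<delta>
    using level[OF that(2)] that(1) word_level_invariant(2) by blast
  obtain q where q: "W h = word_level L \<rho> (diameter \<Gamma>) h q"
    and fine: "\<And>m. m \<in> W h \<Longrightarrow> word_prod \<rho> m * diameter \<Gamma> \<le> h"
    using level[OF \<open>0 < h\<close>] by blast

  \<comment> \<open>All words at all scales up to \<open>H\<close>, which makes \<open>F\<close> a
    single union of cells.\<close>
  define V where "V = (\<Union>\<delta>\<in>{0<..H}. W \<delta>)"
  have F_eq: "F = (\<Union>m\<in>V. word_map S m ` K)"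
    by (auto simp: F_def V_def refined_set_def)
  have image_F: "word_map S m ` K \<subseteq> F" if "m \<in> W h" for m
  proof -
    have "h \<in> {0<..H}" using \<open>0 < h\<close> \<open>h \<le> H\<close> by simp
    then show ?thesis unfolding F_eq V_def using that by blast
  qed
  have V_letters: "set m \<subseteq> {1..L}" if m: "m \<in> V" for m
  proof -
    obtain \<delta> where "\<delta> \<in> {0<..H}" "m \<in> W \<delta>" using m unfolding V_def by blast
    then show ?thesis using W_letters[of m \<delta>] by simp
  qed
  have "\<Gamma> \<subseteq> F"
  proof -
    have "\<Gamma> \<subseteq> (\<Union>m\<in>W h. word_map S m ` \<Gamma>)"
      unfolding q using \<Gamma>(3) by (intro subset_Union_word_level) auto
    also have "\<dots> \<subseteq> F"
      using image_F \<open>\<Gamma> \<subseteq> K\<close> by blast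
    finally show ?thesis .
  qed
  obtain U where U: "open U" "F \<subseteq> U" "C_k_on (Suc k) f U"
    using \<open>C_k_near (k + 1) f F\<close> unfolding C_k_near_def Suc_eq_plus1[symmetric] by blast
  obtain Z where Z: "compact Z" "Z \<subseteq> U" "F \<subseteq> Z"
    using word_images_subset_compact[where S = S and L = L and \<rho> = \<rho> and r = r and K = K and G = \<Gamma>
        and V = V and U = U, OF contr \<rho>0 \<rho>_le r cont \<Gamma>(1,2) S\<Gamma> \<open>\<Gamma> \<subseteq> K\<close> \<open>compact K\<close> V_letters
          U(1) order_trans[OF \<open>\<Gamma> \<subseteq> F\<close> U(2)]] U(2) unfolding F_eq by blast
  \<comment> \<open>The derivative is continuous on the compact \<open>Z\<close>, which contains
    \<open>F\<close>.\<close>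
  have bdd: "bdd_above ((\<lambda>y. \<bar>multi_deriv \<beta> f y\<bar>) ` F)" if "\<beta> \<in> multi_indices (Suc k)" for \<beta>
  proof -
    have "continuous_on Z (\<lambda>y. \<bar>multi_deriv \<beta> f y\<bar>)"
      using continuous_on_multi_deriv[OF U(1,3) that] Z(2)
      by (intro continuous_on_rabs) (rule continuous_on_subset)
    then have "bounded ((\<lambda>y. \<bar>multi_deriv \<beta> f y\<bar>) ` Z)"
      using Z(1) by (intro compact_imp_bounded compact_continuous_image)
    then show ?thesis
      using Z(3) by (meson bdd_above_mono bounded_imp_bdd_above image_mono)
  qed

  define \<sigma> where "\<sigma> = (\<Sum>\<beta>\<in>multi_indices (Suc k). 1 / (\<Prod>i\<in>(UNIV::'n set). fact (\<beta> i)) :: real)"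
  define D where "D = deriv_norm (Suc k) F f"
  \<comment> \<open>Bounds the diameter of every cell at scale \<open>h\<close>: the contraction
    factor of such a cell is at most \<open>h / diameter \<Gamma>\<close>.\<close>
  define \<eta> where "\<eta> = h * (diameter K / diameter \<Gamma>)"
  define R where "R = \<sigma> * \<eta> ^ Suc k * D"
  have \<sigma>: "0 \<le> \<sigma>" unfolding \<sigma>_def by (intro sum_nonneg divide_nonneg_nonneg prod_nonneg) auto
  \<comment> \<open>A point of \<open>F\<close> and a multi-index are needed, since otherwise a
    supremum or maximum over an empty set would be involved.\<close>
  have D: "0 \<le> D"
  proof -
    obtain y where "y \<in> F" using \<Gamma>(2) \<open>\<Gamma> \<subseteq> F\<close> by blast
    obtain \<beta> :: "'n \<Rightarrow> nat" where "\<beta> \<in> multi_indices (Suc k)"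
      using multi_indices_nonempty by blast
    then have "\<bar>multi_deriv \<beta> f y\<bar> \<le> D"
      unfolding D_def using abs_multi_deriv_le_deriv_norm[OF bdd _ \<open>y \<in> F\<close>] by blast
    then show ?thesis by linarith
  qed
  have diamK: "0 \<le> diameter K"
    by (rule diameter_ge_0[OF compact_imp_bounded[OF \<open>compact K\<close>]])
  have \<eta>: "0 \<le> \<eta>" unfolding \<eta>_def using diamK d \<open>0 < h\<close> by simp
  have R: "0 \<le> R" unfolding R_def using \<sigma> D \<eta> by simp

  have local_error: "\<bar>cubature M w x (f \<circ> word_map S m) - (LINT y:\<Gamma>|\<M>. f (word_map S m y))\<bar>
      \<le> ((\<Sum>i\<in>{1..M}. \<bar>w i\<bar>) + 1) * R" if m: "m \<in> W h" for m
  proof -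
    obtain B c where T: "word_map S m = (\<lambda>y. B *v y + c)" using affine by blast
    \<comment> \<open>Any point of \<open>K\<close> will do as preimage of the expansion centre
      \<open>a\<close>.\<close>
    obtain z where z: "z \<in> K" using \<Gamma>(2) \<open>\<Gamma> \<subseteq> K\<close> by blast
    define a where "a = word_map S m z"
    define p where "p y = (\<Sum>j\<le>k. line_deriv j f (word_map S m y - a) a / fact j)" for y
    \<comment> \<open>The shift by \<open>a\<close> is absorbed into the translation part, so that
      the Taylor polynomial is composed with a single affine map.\<close>
    have "p = (\<lambda>y. \<Sum>j\<le>k. line_deriv j f (B *v y + (c - a)) a / fact j)"
      by (simp add: p_def T fun_eq_iff add_diff_eq)
    then have p: "p \<in> poly_space k"
      by (simp only: Taylor_polynomial_in_poly_space)
    \<comment> \<open>An affine image of a convex set is convex, so segments from \<open>a\<close>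
      stay in the cell and hence in \<open>F\<close>.\<close>
    have "word_map S m ` K = (\<lambda>y. c + y) ` ((*v) B ` K)"
      by (auto simp: T image_image add.commute)
    then have conv: "convex (word_map S m ` K)"
      using \<open>convex K\<close> by (simp add: convex_translation convex_linear_image)
    have approx: "\<bar>(f \<circ> word_map S m) y - p y\<bar> \<le> R" if y: "y \<in> K" for y
    proof -
      have "closed_segment a (word_map S m y) \<subseteq> F"
        using closed_segment_subset[OF _ _ conv, of a "word_map S m y"] y z image_F[OF m]
        by (auto simp: a_def)
      from Taylor_remainder_le[OF U(1,3,2) this bdd]
      have "\<bar>f (word_map S m y) - p y\<bar> \<le> \<sigma> * norm (word_map S m y - a) ^ Suc k * D"
        unfolding p_def \<sigma>_def D_def by blast
      also have "\<dots> \<le> \<sigma> * \<eta> ^ Suc k * D"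
      proof (intro mult_right_mono[OF _ D] mult_left_mono[OF _ \<sigma>] power_mono norm_ge_zero)
        have \<rho>m: "0 \<le> word_prod \<rho> m" using \<rho>0 by (intro word_prod_nonneg)
        have "norm (word_map S m y - a) \<le> word_prod \<rho> m * dist y z"
          unfolding a_def dist_norm[symmetric] by (rule dist_word_map_le[where S = S, OF contr \<rho>0])
        also have "\<dots> \<le> word_prod \<rho> m * diameter K"
          by (intro mult_left_mono[OF _ \<rho>m] diameter_bounded_bound compact_imp_bounded \<open>compact K\<close> y z)
        also have "\<dots> \<le> h / diameter \<Gamma> * diameter K"
          using fine[OF m] \<open>0 < diameter \<Gamma>\<close>
          by (intro mult_right_mono[OF _ diamK]) (simp add: pos_le_divide_eq)
        also have "\<dots> = \<eta>" by (simp add: \<eta>_def)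
        finally show "norm (word_map S m y - a) \<le> \<eta>" .
      qed
      finally show ?thesis by (simp add: R_def)
    qed
    have "continuous_on \<Gamma> (f \<circ> word_map S m)"
    proof (rule continuous_on_compose[OF cont])
      have "word_map S m ` \<Gamma> \<subseteq> U"
        using image_F[OF m] \<open>\<Gamma> \<subseteq> K\<close> U(2) by blast
      then show "continuous_on (word_map S m ` \<Gamma>) f"
        by (rule continuous_on_subset[OF C_k_on_imp_continuous_on[OF U(3)]])
    qed
    from cubature_error_le[OF prob_space_axioms sets \<Gamma>(1) this \<open>\<Gamma> \<subseteq> K\<close> \<open>x ` {1..M} \<subseteq> K\<close> exact p approx R]
    show ?thesis by (simp add: comp_def)
  qed

  \<comment> \<open>The children share the weight of their parent because the \<mu> sum to 1, so the
    total remains that of the empty word.\<close>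
  have W_total: "(\<Sum>m\<in>W h. word_prod \<mu> m) = 1"
    unfolding q using \<open>(\<Sum>l\<in>{1..L}. \<mu> l) = 1\<close>
    by (subst sum_word_level) (simp_all add: word_prod_snoc flip: sum_distrib_left)
  have split: "(LINT y:\<Gamma>|\<M>. f y) = (\<Sum>m\<in>W h. word_prod \<mu> m * (LINT y:\<Gamma>|\<M>. f (word_map S m y)))"
  proof -
    \<comment> \<open>Self-similarity applied to \<open>f\<close> composed with
      \<open>word_map S m\<close>; continuity holds because this map sends \<Gamma> into
      itself.\<close>
    have "word_prod \<mu> m * (LINT y:\<Gamma>|\<M>. f (word_map S m y))
        = (\<Sum>l\<in>{1..L}. word_prod \<mu> (m @ [l]) * (LINT y:\<Gamma>|\<M>. f (word_map S (m @ [l]) y)))"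
      if m: "set m \<subseteq> {1..L}" for m
    proof -
      have "word_map S m ` \<Gamma> \<subseteq> U"
        using word_map_image_subset[where S = S, OF m S\<Gamma>] \<open>\<Gamma> \<subseteq> F\<close> U(2) by blast
      then have "continuous_on (word_map S m ` \<Gamma>) f"
        by (rule continuous_on_subset[OF C_k_on_imp_continuous_on[OF U(3)]])
      then have "continuous_on \<Gamma> (\<lambda>y. f (word_map S m y))"
        by (rule continuous_on_compose2[where g = f and f = "word_map S m", OF _ cont order_refl])
      from set_integral_self_similar_measure[OF \<open>is_self_similar_measure L S \<mu> \<M>\<close> \<mu>0
          \<open>(\<Sum>l\<in>{1..L}. \<mu> l) = 1\<close> meas \<Gamma>(1) S\<Gamma> ae this]
      show ?thesis
        by (simp add: sum_distrib_left word_prod_snoc word_map_snoc mult.assoc)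
    qed
    from sum_word_level[where I = "\<lambda>m. word_prod \<mu> m * (LINT y:\<Gamma>|\<M>. f (word_map S m y))", OF this]
    show ?thesis unfolding q by simp
  qed
  have "\<bar>refined_cubature S \<mu> (W h) M w x f - (LINT y:\<Gamma>|\<M>. f y)\<bar>
      = \<bar>\<Sum>m\<in>W h. word_prod \<mu> m *
          (cubature M w x (f \<circ> word_map S m) - (LINT y:\<Gamma>|\<M>. f (word_map S m y)))\<bar>"
    unfolding refined_cubature_def split by (simp add: right_diff_distrib sum_subtractf)
  also have "\<dots> \<le> (\<Sum>m\<in>W h. word_prod \<mu> m * (((\<Sum>i\<in>{1..M}. \<bar>w i\<bar>) + 1) * R))"
  proof (rule order_trans[OF sum_abs sum_mono])
    fix m
    assume m: "m \<in> W h"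
    have "0 \<le> word_prod \<mu> m"
      using \<mu>0 W_letters[OF m \<open>0 < h\<close>] by (intro word_prod_nonneg) blast
    then show "\<bar>word_prod \<mu> m *
          (cubature M w x (f \<circ> word_map S m) - (LINT y:\<Gamma>|\<M>. f (word_map S m y)))\<bar>
        \<le> word_prod \<mu> m * (((\<Sum>i\<in>{1..M}. \<bar>w i\<bar>) + 1) * R)"
      unfolding abs_mult using local_error[OF m] by (simp add: mult_left_mono)
  qed
  also have "\<dots> = ((\<Sum>i\<in>{1..M}. \<bar>w i\<bar>) + 1) * R"
    unfolding sum_distrib_right[symmetric] W_total by simp
  also have "\<dots> = C * h ^ (k + 1) * deriv_norm (k + 1) F f"
    unfolding C_def R_def \<sigma>_def D_def \<eta>_def power_mult_distrib Suc_eq_plus1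
    by (simp only: mult_ac)
  finally show ?thesis .
qed

end
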